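(* Let $\mathcal{C}$ be the class of almost smooth circle maps with a flat spot whose critical exponent is $(\nu,\nu)$ for some $\nu>1$ and whose rotation number is irrational. Then no map in $\mathcal{C}$ has a wandering interval, and any two maps in $\mathcal{C}$ with the same (irrational) rotation number are topologically conjugate.
   Context: An almost smooth map with a flat spot is a continuous, weakly order-preserving, degree one circle endomorphism $F:{\bf S}^1\to{\bf S}^1$ for which there is an open arc $U$ (the flat spot) such that: (1) $F(U)$ is one point; (2) the restriction of $F$ to ${\bf S}^1\setminus\overline{U}$ is a $C^2$-diffeomorphism onto its image; (3) if $f$ is a lifting of $F$ to the real line and $(a,b)$ is a lift of $U$, then on some right-sided neighborhood of $b$ one has $f(x)=h_r((x-b)^{p_r})$ with $p_r\ge 1$, where $h_r$ extends as a $C^2$-diffeomorphism to a full neighborhood of the relevant endpoint, and analogously on some left-sided neighborhood of $a$ one has $f(x)=h_l((a-x)^{p_l})$ with $p_l\geq 1$. The pair $(p_l,p_r)$ is the critical exponent. The rotation number is $\rho(F)=\lim_{n\to\infty} f^n(x)/n \pmod 1$, which exists and does not depend on $x$. A wandering interval of $F$ is a non-degenerate interval $J\subset {\bf S}^1\setminus\bigcup_{i\ge 0}F^{-i}(U)$ whose images $F^i(J)$, $i\ge 0$, are pairwise disjoint (the flat spot and its preimages, which collapse to points, are not counted as wandering intervals). Two maps $F,G$ are topologically conjugate if there is a homeomorphism $h$ of ${\bf S}^1$ with $h\circ F=G\circ h$. *)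

theory Defs
  imports "HOL-Analysis.Analysis"
begin

text \<open>
  The circle is the unit circle of the complex plane, with universal covering
  \<open>x \<mapsto> cis (2 * pi * x)\<close> of period 1.  Circle maps are functions on \<open>complex\<close>;
  their values off the unit circle are irrelevant.
\<close>

abbreviation circle :: "complex set" where
  "circle \<equiv> sphere 0 1"

definition cproj :: "real \<Rightarrow> complex" where
  "cproj x = cis (2 * pi * x)"

definition is_lift :: "(complex \<Rightarrow> complex) \<Rightarrow> (real \<Rightarrow> real) \<Rightarrow> bool" where
  "is_lift F f \<longleftrightarrow> continuous_on UNIV f \<and> (\<forall>x. F (cproj x) = cproj (f x))"

text \<open>
  Any two lifts differ by an integer constant, so asking for one monotone lift of
  degree one is the same as asking it of all lifts.
\<close>

definition monotone_degree_one :: "(complex \<Rightarrow> complex) \<Rightarrow> bool" where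
  "monotone_degree_one F \<longleftrightarrow>
     continuous_on circle F \<and> F ` circle \<subseteq> circle \<and>
     (\<exists>f. is_lift F f \<and> mono f \<and> (\<forall>x. f (x + 1) = f x + 1))"

text \<open>
  The bound \<open>b \<le> a + 1\<close> makes \<open>{a<..<b}\<close> a connected component of the preimage of \<open>U\<close>.
\<close>

definition is_arc_lift :: "complex set \<Rightarrow> real \<Rightarrow> real \<Rightarrow> bool" where
  "is_arc_lift U a b \<longleftrightarrow> a < b \<and> b \<le> a + 1 \<and> U = cproj ` {a<..<b}"

definition open_arc :: "complex set \<Rightarrow> bool" where
  "open_arc U \<longleftrightarrow> (\<exists>a b. is_arc_lift U a b)"

definition C2_on :: "(real \<Rightarrow> 'a::real_normed_vector) \<Rightarrow> real set \<Rightarrow> bool" where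
  "C2_on g S \<longleftrightarrow>
     (\<exists>g'. (\<forall>t\<in>S. (g has_vector_derivative g' t) (at t)) \<and> g' C1_differentiable_on S)"

definition C2_diffeo_on :: "(real \<Rightarrow> real) \<Rightarrow> real set \<Rightarrow> bool" where
  "C2_diffeo_on g S \<longleftrightarrow>
     open S \<and> open (g ` S) \<and> inj_on g S \<and> C2_on g S \<and> C2_on (the_inv_into S g) (g ` S)"

text \<open>
  Since \<open>cproj\<close> is a smooth covering and the circle is an embedded submanifold of the plane,
  a circle-valued map on an open subset \<open>V\<close> of the circle is \<open>C\<^sup>2\<close> iff its composition with
  \<open>cproj\<close> is a \<open>C\<^sup>2\<close> plane-valued function on the preimage of \<open>V\<close>.
\<close>

definition circle_C2_on :: "(complex \<Rightarrow> complex) \<Rightarrow> complex set \<Rightarrow> bool" where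
  "circle_C2_on F V \<longleftrightarrow> C2_on (F \<circ> cproj) (cproj -` V)"

definition circle_C2_diffeo_on :: "(complex \<Rightarrow> complex) \<Rightarrow> complex set \<Rightarrow> bool" where
  "circle_C2_diffeo_on F V \<longleftrightarrow>
     openin (top_of_set circle) V \<and> openin (top_of_set circle) (F ` V) \<and> inj_on F V \<and>
     circle_C2_on F V \<and> circle_C2_on (the_inv_into V F) (F ` V)"

text \<open>
  The function \<open>h\<close> below is the extension to a full neighbourhood of 0.  No relation between
  \<open>\<epsilon>\<close> and \<open>\<delta>\<close> is needed, because \<open>\<epsilon>\<close> may be decreased.
\<close>

definition right_power_law :: "(real \<Rightarrow> real) \<Rightarrow> real \<Rightarrow> real \<Rightarrow> bool" where
  "right_power_law f b p \<longleftrightarrow>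
     (\<exists>h. \<exists>\<delta>>0. \<exists>\<epsilon>>0. C2_diffeo_on h {-\<delta><..<\<delta>} \<and>
        (\<forall>x\<in>{b..<b + \<epsilon>}. f x = h ((x - b) powr p)))"

definition left_power_law :: "(real \<Rightarrow> real) \<Rightarrow> real \<Rightarrow> real \<Rightarrow> bool" where
  "left_power_law f a p \<longleftrightarrow>
     (\<exists>h. \<exists>\<delta>>0. \<exists>\<epsilon>>0. C2_diffeo_on h {-\<delta><..<\<delta>} \<and>
        (\<forall>x\<in>{a - \<epsilon><..a}. f x = h ((a - x) powr p)))"

text \<open>
  \<open>F\<close> is an almost smooth map with flat spot \<open>U\<close> and critical exponent \<open>(pl, pr)\<close>.
  Both \<open>U\<close> and the exponent are determined by \<open>F\<close>.
\<close>

definition almost_smooth_flat ::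
    "(complex \<Rightarrow> complex) \<Rightarrow> complex set \<Rightarrow> real \<Rightarrow> real \<Rightarrow> bool" where
  "almost_smooth_flat F U pl pr \<longleftrightarrow>
     monotone_degree_one F \<and>
     open_arc U \<and>
     (\<exists>c. F ` U = {c}) \<and>
     circle_C2_diffeo_on F (circle - closure U) \<and>
     1 \<le> pl \<and> 1 \<le> pr \<and>
     (\<forall>f a b. is_lift F f \<and> is_arc_lift U a b \<longrightarrow>
        right_power_law f b pr \<and> left_power_law f a pl)"

text \<open>
  The rotation number, an element of the reals modulo 1, is represented in \<open>{0..<1}\<close>.
\<close>

definition rotation_number :: "(complex \<Rightarrow> complex) \<Rightarrow> real" where
  "rotation_number F =
     (THE r. \<forall>f x. is_lift F f \<longrightarrow>
        (\<exists>l. (\<lambda>n. (f ^^ n) x / real n) \<longlonglongrightarrow> l \<and> r = frac l))"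

definition flat_class :: "(complex \<Rightarrow> complex) set" where
  "flat_class =
     {F. \<exists>U \<nu>. \<nu> > 1 \<and> almost_smooth_flat F U \<nu> \<nu> \<and> rotation_number F \<notin> \<rat>}"

definition wandering_interval ::
    "(complex \<Rightarrow> complex) \<Rightarrow> complex set \<Rightarrow> complex set \<Rightarrow> bool" where
  "wandering_interval F U J \<longleftrightarrow>
     connected J \<and> (\<exists>x\<in>J. \<exists>y\<in>J. x \<noteq> y) \<and>
     J \<subseteq> circle - (\<Union>i. (F ^^ i) -` U) \<and>
     disjoint_family (\<lambda>i. (F ^^ i) ` J)"

definition has_wandering_interval :: "(complex \<Rightarrow> complex) \<Rightarrow> bool" where
  "has_wandering_interval F \<longleftrightarrow>
     (\<exists>U pl pr J. almost_smooth_flat F U pl pr \<and> wandering_interval F U J)"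

definition topologically_conjugate ::
    "(complex \<Rightarrow> complex) \<Rightarrow> (complex \<Rightarrow> complex) \<Rightarrow> bool" where
  "topologically_conjugate F G \<longleftrightarrow>
     (\<exists>h k. homeomorphism circle circle h k \<and> (\<forall>z\<in>circle. h (F z) = G (h z)))"

end

theory Submission
  imports Defs "HOL-Analysis.Kronecker_Approximation_Theorem"
begin

text \<open>
  Lift \<open>F\<close> to \<open>f\<close> and let \<open>H\<close> be a monotone semiconjugacy to the translation by the irrational
  \<open>\<rho>\<close>, normalised to vanish on the flat interval \<open>[\<alpha>, \<beta>]\<close>.  The fibres of \<open>H\<close> are points or closed
  intervals, and everything reduces to showing that a fibre over a point outside the backward orbit
  of \<open>0\<close> is a point.  This is done with the cross-ratio of an interval and its two neighbouring
  gaps: power maps of exponent at least 1 decrease it, \<open>C\<^sup>2\<close> diffeomorphisms increase it at most by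
  a factor exponential in the length, and a gap that contains the flat interval costs only a
  bounded factor.  Along a stretch of orbit with bounded total length the cross-ratio therefore
  grows at most by a constant, which is incompatible with a nondegenerate fibre.

  The fibres of \<open>H\<close> are then points, except for the iterated preimages of the flat interval, which
  \<open>f\<close> permutes homeomorphically.  For two maps with the same \<open>\<rho>\<close> the order-preserving
  correspondence of fibres extends to a conjugacy once the two flat intervals are identified.
\<close>

section \<open>Monotone degree one lifts\<close>

text \<open>Denjoy's classical argument bounds the variation of \<open>log f'\<close> and is blocked
  at the ends of the flat interval: with an exponent above 1 the derivative tends to 0 there.
  Cross-ratios survive because the singular factor of the map is a power. A gap across the flat
  interval is affordable because its length is at least \<beta> - \<alpha>: the factor is absorbed
  into the exponential of the length, and bounded total length permits only boundedly many such
  gaps. That bound comes from the rotation: up to a closest return time the orbit points are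
  separated by a distance D, while the gaps reach at most 2D, so the overlaps are bounded. Fibres
  outside the backward orbit suffice for the following reason. Were the fibre over 0 larger than
  [\<alpha>, \<beta>], its image over \<rho> would be nondegenerate, although by irrationality
  \<rho> never reaches 0 modulo 1. A fibre that does reach 0 is mapped strictly increasingly all the
  way to the flat interval.\<close>

locale degree_one_lift =
  fixes f :: "real \<Rightarrow> real"
  assumes cont: "continuous_on UNIV f"
    and mono_f: "mono f"
    and shift1: "f (x + 1) = f x + 1"
begin

lemma funpow_mono: "mono (f ^^ n)"
proof (induction n)
  case (Suc n)
  then show ?case by (simp add: mono_def monoD[OF mono_f])
qed (simp add: mono_def)

lemma shift_nat: "f (x + of_nat k) = f x + of_nat k"
proof (induction k arbitrary: x)
  case (Suc k)
  show ?case using shift1[of "x + of_nat k"] Suc by (simp add: algebra_simps)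
qed simp

lemma shift_int: "f (x + of_int k) = f x + of_int k"
proof (cases "0 \<le> k")
  case True then show ?thesis using shift_nat[of x "nat k"] by simp
next
  case False then show ?thesis using shift_nat[of "x + of_int k" "nat (- k)"] by simp
qed

lemma funpow_shift_int: "(f ^^ n) (x + of_int k) = (f ^^ n) x + of_int k"
  by (induction n) (auto simp: shift_int)

lemma funpow_cont: "continuous_on UNIV (f ^^ n)"
proof (induction n)
  case (Suc n)
  have "continuous_on ((f ^^ n) ` UNIV) f"
    using cont by (rule continuous_on_subset) simp
  with Suc show ?case using continuous_on_compose[of UNIV "f ^^ n" f] by simp
qed (simp add: continuous_on_id id_def)

text \<open>Any \<open>y\<close> lies between two consecutive integer translates of
  \<open>x\<close>, and monotone iterates commuting with these translations preserve this.\<close>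

lemma displacement_diff: "\<bar>((f ^^ n) y - y) - ((f ^^ n) x - x)\<bar> \<le> 1"
proof -
  define k where "k = \<lfloor>y - x\<rfloor>"
  have k: "x + of_int k \<le> y" "y \<le> x + of_int (k + 1)"
    unfolding k_def by linarith+
  have "(f ^^ n) x + of_int k \<le> (f ^^ n) y" "(f ^^ n) y \<le> (f ^^ n) x + of_int (k + 1)"
    using monoD[OF funpow_mono k(1), of n] monoD[OF funpow_mono k(2), of n]
    by (simp_all add: funpow_shift_int del: of_int_add)
  then show ?thesis using k by simp
qed

lemma displacement_mult:
  "\<bar>((f ^^ (m * n)) x - x) - real m * ((f ^^ n) x - x)\<bar> \<le> real m"
proof (induction m)
  case (Suc m)
  have eq: "(f ^^ (Suc m * n)) x = (f ^^ n) ((f ^^ (m * n)) x)"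
    by (simp add: funpow_add)
  have "\<bar>((f ^^ n) ((f ^^ (m * n)) x) - (f ^^ (m * n)) x) - ((f ^^ n) x - x)\<bar> \<le> 1"
    by (rule displacement_diff)
  then show ?case using Suc unfolding eq by (simp add: algebra_simps)
qed simp

text \<open>Both quotients are compared with the one at the common time \<open>m * n\<close>. The
  Cauchy property, and the error bound after \<open>m\<close> tends to infinity, follow from this
  estimate.\<close>

lemma displacement_quotients:
  assumes "0 < m" "0 < n"
  shows "\<bar>((f ^^ m) x - x) / real m - ((f ^^ n) x - x) / real n\<bar> \<le> 1 / real m + 1 / real n"
proof -
  have *: "\<bar>((f ^^ (m * n)) x - x) / real (m * n) - ((f ^^ n) x - x) / real n\<bar> \<le> 1 / real n"
    if "0 < m" "0 < n" for m n
  proof -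
    have "((f ^^ (m * n)) x - x) / real (m * n) - ((f ^^ n) x - x) / real n
        = (((f ^^ (m * n)) x - x) - real m * ((f ^^ n) x - x)) / real (m * n)"
      using that by (simp add: field_simps)
    also have "\<bar>\<dots>\<bar> \<le> real m / real (m * n)"
      using displacement_mult[of m n x] that unfolding abs_divide
      by (intro frac_le) auto
    finally show ?thesis using that by simp
  qed
  show ?thesis using *[OF assms] *[OF assms(2,1)] by (simp add: mult.commute)
qed

lemma rotation_limit:
  obtains \<rho> where "\<And>x. (\<lambda>n. (f ^^ n) x / real n) \<longlonglongrightarrow> \<rho>"
    "\<And>n x. \<bar>(f ^^ n) x - x - real n * \<rho>\<bar> \<le> 1"
proof -
  have C: "convergent (\<lambda>n. ((f ^^ n) x - x) / real n)" for x
    unfolding Cauchy_convergent_iff[symmetric]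
  proof (rule CauchyI)
    fix e :: real assume "0 < e"
    then obtain N :: nat where N: "0 < N" "1 / real N < e / 2"
      using real_arch_invD[of "e/2"] by (auto simp: inverse_eq_divide)
    show "\<exists>M. \<forall>m\<ge>M. \<forall>n\<ge>M. norm (((f ^^ m) x - x) / real m - ((f ^^ n) x - x) / real n) < e"
    proof (intro exI allI impI)
      fix m n assume mn: "N \<le> m" "N \<le> n"
      then have "1 / real m \<le> 1 / real N" "1 / real n \<le> 1 / real N"
        using N by (auto intro!: frac_le)
      then show "norm (((f ^^ m) x - x) / real m - ((f ^^ n) x - x) / real n) < e"
        using displacement_quotients[of m n x] mn N by simp
    qed
  qed
  define r where "r x = lim (\<lambda>n. ((f ^^ n) x - x) / real n)" for x
  have r: "(\<lambda>n. ((f ^^ n) x - x) / real n) \<longlonglongrightarrow> r x" for x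
    using C convergent_LIMSEQ_iff unfolding r_def by blast
  have xn: "(\<lambda>n. c / real n) \<longlonglongrightarrow> 0" for c
    by (rule lim_const_over_n)
  have r': "(\<lambda>n. (f ^^ n) x / real n) \<longlonglongrightarrow> r x" for x
    using tendsto_add[OF r[of x] xn[of x]] by (simp add: diff_divide_distrib)
  have bd: "\<bar>(f ^^ n) x - x - real n * r x\<bar> \<le> 1" for n x
  proof (cases "n = 0")
    case False
    have "\<bar>((f ^^ n) x - x) / real n - r x\<bar> \<le> 1 / real n"
    proof (rule LIMSEQ_le)
      show "(\<lambda>m. \<bar>((f ^^ n) x - x) / real n - ((f ^^ m) x - x) / real m\<bar>)
              \<longlonglongrightarrow> \<bar>((f ^^ n) x - x) / real n - r x\<bar>"
        by (intro tendsto_intros r)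
      show "(\<lambda>m. 1 / real n + 1 / real m) \<longlonglongrightarrow> 1 / real n"
        using tendsto_add[OF tendsto_const[of "1 / real n"] xn[of 1]] by simp
      show "\<exists>N. \<forall>m\<ge>N. \<bar>((f ^^ n) x - x) / real n - ((f ^^ m) x - x) / real m\<bar>
              \<le> 1 / real n + 1 / real m"
        using displacement_quotients[of n _ x] False by (intro exI[of _ 1]) auto
    qed
    moreover have "((f ^^ n) x - x) / real n - r x = ((f ^^ n) x - x - real n * r x) / real n"
      using False by (simp add: field_simps)
    ultimately show ?thesis using False by (simp add: divide_le_cancel)
  qed simp
  have eq: "r x = r 0" for x
  proof -
    have "(\<lambda>n. ((f ^^ n) x - x) / real n - ((f ^^ n) 0 - 0) / real n) \<longlonglongrightarrow> 0"
    proof (rule tendsto_rabs_zero_cancel, rule tendsto_sandwich[OF _ _ tendsto_const xn[of 1]])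
      show "\<forall>\<^sub>F n in sequentially. \<bar>((f ^^ n) x - x) / real n - ((f ^^ n) 0 - 0) / real n\<bar> \<le> 1 / real n"
      proof (rule eventually_sequentiallyI[of 1])
        fix n :: nat assume "1 \<le> n"
        then show "\<bar>((f ^^ n) x - x) / real n - ((f ^^ n) 0 - 0) / real n\<bar> \<le> 1 / real n"
          using displacement_diff[of n x 0]
          by (simp add: diff_divide_distrib[symmetric] divide_right_mono)
      qed
    qed simp
    moreover have "(\<lambda>n. ((f ^^ n) x - x) / real n - ((f ^^ n) 0 - 0) / real n) \<longlonglongrightarrow> r x - r 0"
      by (intro tendsto_diff r)
    ultimately show ?thesis using LIMSEQ_unique by fastforce
  qed
  show thesis
    using that[of "r 0"] r' bd eq by metis
qed

end

section \<open>Integer multiples of an irrational number\<close>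

lemma irrational_multiple_ne:
  fixes \<rho> :: real
  assumes "\<rho> \<notin> \<rat>" "k \<noteq> 0"
  shows "of_int k * \<rho> \<noteq> of_int m"
proof
  assume "of_int k * \<rho> = of_int m"
  then have "\<rho> = of_int m / of_int k" using assms(2) by (simp add: field_simps)
  then show False using assms(1) by auto
qed

text \<open>
  Here \<open>Q\<close> is a closest return time of the rotation and \<open>D\<close> is the smallest distance to \<open>\<int>\<close>
  among the multiples before it, attained at \<open>m\<^sub>0\<close>.  Modulo 1 the point \<open>N\<rho>\<close> has
  the neighbours of index \<open>N \<plusminus> m\<^sub>0\<close>, corrected by \<open>Q\<close> when this leaves \<open>{..<Q}\<close>.
\<close>

lemma closest_return:
  fixes \<rho> \<epsilon> :: real
  assumes irr: "\<rho> \<notin> \<rat>" and "0 < \<epsilon>"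
  obtains Q :: nat and D :: real where "0 < D" "D < \<epsilon>" "0 < Q"
    "\<And>i j m. i < Q \<Longrightarrow> j < Q \<Longrightarrow> i \<noteq> j \<Longrightarrow> D \<le> \<bar>(real i - real j) * \<rho> - of_int m\<bar>"
    "\<And>N. N < Q \<Longrightarrow> \<exists>l<Q. \<exists>m. 0 < (real l - real N) * \<rho> + of_int m
                              \<and> (real l - real N) * \<rho> + of_int m \<le> 2 * D"
    "\<And>N. N < Q \<Longrightarrow> \<exists>l<Q. \<exists>m. (real l - real N) * \<rho> + of_int m < 0
                              \<and> - 2 * D \<le> (real l - real N) * \<rho> + of_int m"
proof -
  define d where "d n = \<bar>real n * \<rho> - of_int (round (real n * \<rho>))\<bar>" for n :: nat
  have d_le: "d n \<le> \<bar>real n * \<rho> - of_int m\<bar>" for n m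
    unfolding d_def by (rule round_diff_minimal)
  have d_pos: "0 < d n" if "0 < n" for n
    using irrational_multiple_ne[OF irr, of "int n" "round (real n * \<rho>)"] that
    by (simp add: d_def)
  have small: "\<exists>n>0. d n < e" if e: "0 < e" for e
  proof -
    obtain N :: nat where N: "0 < N" "1 / real N < e"
      using real_arch_invD[OF e] by (auto simp: inverse_eq_divide)
    obtain h k where hk: "0 < k" "\<bar>of_int k * \<rho> - of_int h\<bar> < 1 / N"
      using Dirichlet_approx[of N \<rho>] N by blast
    then have "d (nat k) < e" using d_le[of "nat k" h] N by simp
    then show ?thesis using hk by (intro exI[of _ "nat k"]) auto
  qed
  obtain i0 where i0: "0 < i0" "d i0 < \<epsilon>" using small[OF \<open>0 < \<epsilon>\<close>] by blast
  \<comment> \<open>The minimum over all times up to \<open>i0\<close> forces the first improvement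
    \<open>Q\<close> to come after \<open>i0\<close>, hence after \<open>m0\<close>; the
    construction of neighbours needs \<open>m0 < Q\<close>.\<close>
  define D where "D = Min (d ` {1..i0})"
  have D_le: "D \<le> d i" if "1 \<le> i" "i \<le> i0" for i
    unfolding D_def using that by (intro Min_le) auto
  have "D \<in> d ` {1..i0}" unfolding D_def using i0 by (intro Min_in) auto
  then obtain m0 where m0: "1 \<le> m0" "m0 \<le> i0" "d m0 = D" by auto
  have "0 < D" using m0 d_pos[of m0] by simp
  have "D < \<epsilon>" using D_le[of i0] i0 by simp
  define Q where "Q = (LEAST q. 0 < q \<and> d q < D)"
  have Q: "0 < Q" "d Q < D"
    using LeastI_ex[OF small[OF \<open>0 < D\<close>]] unfolding Q_def by auto
  have before: "D \<le> d i" if "0 < i" "i < Q" for i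
    using not_less_Least[of i "\<lambda>q. 0 < q \<and> d q < D"] that unfolding Q_def[symmetric] by auto
  have "i0 < Q" using D_le[of Q] Q by (cases "i0 < Q") auto
  have sep: "D \<le> \<bar>(real i - real j) * \<rho> - of_int m\<bar>" if "i < Q" "j < i" for i j m
  proof -
    have "i - j < Q" using that by linarith
    then show ?thesis
      using before[of "i - j"] d_le[of "i - j" m] that by (simp add: of_nat_diff less_imp_le)
  qed
  define a where "a = round (real m0 * \<rho>)"
  define b where "b = round (real Q * \<rho>)"
  define \<sigma> where "\<sigma> = real m0 * \<rho> - of_int a"
  define \<tau> where "\<tau> = real Q * \<rho> - of_int b"
  have \<sigma>: "\<bar>\<sigma>\<bar> = D" using m0 by (simp add: d_def \<sigma>_def a_def)
  have \<tau>: "\<bar>\<tau>\<bar> < D" using Q by (simp add: d_def \<tau>_def b_def)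
  \<comment> \<open>Since |\<tau>| < D = |\<sigma>|, the correction by \<tau> keeps the sign of
    \<sigma> and at most doubles its size; this is the origin of the bound
    \<open>2 * D\<close>.\<close>
  have fwd: "\<exists>l<Q. \<exists>m s. (real l - real N) * \<rho> + of_int m = s \<and> (s = \<sigma> \<or> s = \<sigma> - \<tau>)"
    if "N < Q" for N
  proof (cases "N + m0 < Q")
    case True
    have "(real (N + m0) - real N) * \<rho> + of_int (- a) = \<sigma>" by (simp add: \<sigma>_def)
    with True show ?thesis by blast
  next
    case False
    have "(real (N + m0 - Q) - real N) * \<rho> + of_int (b - a) = \<sigma> - \<tau>"
      using False by (simp add: \<sigma>_def \<tau>_def of_nat_diff algebra_simps)
    moreover have "N + m0 - Q < Q" using False that m0 \<open>i0 < Q\<close> by linarith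
    ultimately show ?thesis by blast
  qed
  have bwd: "\<exists>l<Q. \<exists>m s. (real l - real N) * \<rho> + of_int m = s \<and> (s = - \<sigma> \<or> s = - \<sigma> + \<tau>)"
    if "N < Q" for N
  proof (cases "m0 \<le> N")
    case True
    have "(real (N - m0) - real N) * \<rho> + of_int a = - \<sigma>"
      using True by (simp add: \<sigma>_def of_nat_diff algebra_simps)
    moreover have "N - m0 < Q" using that by simp
    ultimately show ?thesis by blast
  next
    case False
    then have le: "m0 \<le> N + Q" using m0 \<open>i0 < Q\<close> by linarith
    have "(real (N + Q - m0) - real N) * \<rho> + of_int (a - b) = - \<sigma> + \<tau>"
      using le by (simp add: \<sigma>_def \<tau>_def of_nat_diff algebra_simps)
    moreover have "N + Q - m0 < Q" using False le Q(1) by linarith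
    ultimately show ?thesis by blast
  qed
  show thesis
  proof (rule that[of D Q])
    show "D \<le> \<bar>(real i - real j) * \<rho> - of_int m\<bar>" if "i < Q" "j < Q" "i \<noteq> j" for i j m
    proof (cases "j < i")
      case False
      then have "D \<le> \<bar>(real j - real i) * \<rho> - of_int (- m)\<bar>" using that by (intro sep) auto
      then show ?thesis by (simp add: algebra_simps abs_minus_commute)
    qed (use that sep in auto)
    show "\<exists>l<Q. \<exists>m. 0 < (real l - real N) * \<rho> + of_int m \<and> (real l - real N) * \<rho> + of_int m \<le> 2 * D"
      if "N < Q" for N
    proof (cases "0 < \<sigma>")
      case True
      then have "0 < s \<and> s \<le> 2 * D" if "s = \<sigma> \<or> s = \<sigma> - \<tau>" for s using that \<sigma> \<tau> by auto
      then show ?thesis using fwd[OF that] by metis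
    next
      case False
      then have "0 < s \<and> s \<le> 2 * D" if "s = - \<sigma> \<or> s = - \<sigma> + \<tau>" for s using that \<sigma> \<tau> by auto
      then show ?thesis using bwd[OF that] by metis
    qed
    show "\<exists>l<Q. \<exists>m. (real l - real N) * \<rho> + of_int m < 0 \<and> - 2 * D \<le> (real l - real N) * \<rho> + of_int m"
      if "N < Q" for N
    proof (cases "0 < \<sigma>")
      case False
      then have "s < 0 \<and> - 2 * D \<le> s" if "s = \<sigma> \<or> s = \<sigma> - \<tau>" for s using that \<sigma> \<tau> by auto
      then show ?thesis using fwd[OF that] by metis
    next
      case True
      then have "s < 0 \<and> - 2 * D \<le> s" if "s = - \<sigma> \<or> s = - \<sigma> + \<tau>" for s using that \<sigma> \<tau> by auto
      then show ?thesis using bwd[OF that] by metis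
    qed
  qed (use \<open>0 < D\<close> \<open>D < \<epsilon>\<close> Q in auto)
qed

lemma small_positive_step:
  fixes \<rho> \<epsilon> :: real
  assumes "\<rho> \<notin> \<rat>" "0 < \<epsilon>"
  obtains n :: nat and m :: int where "0 < n" "0 < real n * \<rho> + of_int m" "real n * \<rho> + of_int m < \<epsilon>"
proof -
  obtain Q :: nat and D where QD: "0 < D" "D < min (1/2) (\<epsilon> / 2)" "0 < Q"
    "\<And>N. N < Q \<Longrightarrow> \<exists>l<Q. \<exists>m. 0 < (real l - real N) * \<rho> + of_int m
                              \<and> (real l - real N) * \<rho> + of_int m \<le> 2 * D"
    using closest_return[OF assms(1), of "min (1/2) (\<epsilon>/2)"] assms(2)
    by (metis half_gt_zero min_less_iff_conj zero_less_one)
  obtain l m where lm: "0 < real l * \<rho> + of_int m" "real l * \<rho> + of_int m \<le> 2 * D"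
    using QD(4)[OF QD(3)] by auto
  have "l \<noteq> 0"
  proof
    assume "l = 0"
    then have "0 < real_of_int m" "real_of_int m < 1" using lm QD by auto
    then show False by auto
  qed
  then show thesis using that[of l m] lm QD by auto
qed

text \<open>Steps shorter than \<open>v - u\<close> cannot jump over the interval. Starting from the
  integer \<open>c\<close> below \<open>u\<close> makes the number of steps nonnegative, so that a
  natural multiple of \<rho> results.\<close>

lemma dense_multiples:
  fixes \<rho> u v :: real
  assumes "\<rho> \<notin> \<rat>" "u < v"
  obtains n :: nat and m :: int where "u < real n * \<rho> + of_int m" "real n * \<rho> + of_int m < v"
proof -
  obtain n :: nat and m :: int where nm: "0 < real n * \<rho> + of_int m" "real n * \<rho> + of_int m < v - u"
    using small_positive_step[OF assms(1), of "v - u"] assms(2) by (metis diff_gt_0_iff_gt)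
  define s where "s = real n * \<rho> + of_int m"
  define c where "c = \<lfloor>u\<rfloor>"
  define j where "j = \<lfloor>(u - of_int c) / s\<rfloor> + 1"
  have c: "of_int c \<le> u" unfolding c_def by linarith
  then have "0 \<le> (u - of_int c) / s" using nm by (auto simp: s_def)
  then have j: "0 \<le> j" unfolding j_def by linarith
  have "(u - of_int c) / s < of_int j" "of_int j \<le> (u - of_int c) / s + 1"
    unfolding j_def by linarith+
  moreover have s: "0 < s" using nm unfolding s_def by simp
  ultimately have "u - of_int c < of_int j * s" "of_int j * s \<le> (u - of_int c) + s"
    by (auto simp: field_simps)
  moreover have "of_int j * s + of_int c = real (nat j * n) * \<rho> + of_int (j * m + c)"
    using j by (simp add: s_def algebra_simps)
  ultimately show thesis using that[of "nat j * n" "j * m + c"] nm(2) unfolding s_def[symmetric]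
    by linarith
qed

section \<open>The semiconjugacy to the rotation\<close>

locale rotation_semiconjugacy = degree_one_lift +
  fixes H :: "real \<Rightarrow> real" and \<rho> :: real
  assumes irr: "\<rho> \<notin> \<rat>"
    and H_cont: "continuous_on UNIV H"
    and H_mono: "mono H"
    and H_shift1: "H (x + 1) = H x + 1"
    and H_f: "H (f x) = H x + \<rho>"

lemma (in degree_one_lift) obtain_semiconjugacy:
  assumes irr: "\<rho> \<notin> \<rat>" and bd: "\<And>n x. \<bar>(f ^^ n) x - x - real n * \<rho>\<bar> \<le> 1"
  obtains H where "rotation_semiconjugacy f H \<rho>"
proof -
  define a where "a x k = (f ^^ k) x - real k * \<rho>" for x k
  have a: "x - 1 \<le> a x k" "a x k \<le> x + 1" for x k
    using bd[of k x] unfolding a_def by linarith+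
  have bdd: "bdd_above (a x ` {n..})" for x n
    using a(2)[of x] by (intro bdd_aboveI[of _ "x + 1"]) auto
  \<comment> \<open>\<open>T x n\<close> is a tail supremum, so \<open>H\<close> is the limsup of
    \<open>(f ^^ k) x - k * \<rho>\<close>. A limsup ignores a shift of the index, which makes the
    semiconjugacy equation exact.\<close>
  define T where "T x n = (SUP k\<in>{n..}. a x k)" for x n
  define H where "H x = lim (T x)" for x
  have T_ge: "x - 1 \<le> T x n" for x n
    unfolding T_def using a(1)[of x n] by (intro cSUP_upper2[OF bdd, of n]) auto
  have "decseq (T x)" for x
    unfolding T_def by (intro decseq_SucI cSUP_subset_mono bdd) auto
  then have lim: "T x \<longlonglongrightarrow> H x" for x
    using decseq_convergent[of "T x" "x - 1"] T_ge unfolding H_def by (metis limI)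
  have H_mono: "mono H"
  proof (rule monoI)
    fix x y :: real assume "x \<le> y"
    have "a x k \<le> a y k" for k
      using monoD[OF funpow_mono \<open>x \<le> y\<close>] unfolding a_def by simp
    then have "T x n \<le> T y n" for n
      unfolding T_def by (intro cSUP_mono bdd) auto
    then show "H x \<le> H y" using LIMSEQ_le[OF lim[of x] lim[of y]] by auto
  qed
  have a_shift: "a (x + of_int m) k = a x k + of_int m" for x m k
    unfolding a_def by (simp add: funpow_shift_int)
  have SUP_add: "(SUP k\<in>{n::nat..}. g k + c) = (SUP k\<in>{n..}. g k) + c"
    if "bdd_above (g ` {n..})" for g and c :: real and n
  proof (rule antisym)
    have le: "g k \<le> (SUP k\<in>{n..}. g k)" if "n \<le> k" for k
      using that \<open>bdd_above (g ` {n..})\<close> by (intro cSUP_upper) auto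
    then have "bdd_above ((\<lambda>k. g k + c) ` {n..})"
      by (intro bdd_aboveI[of _ "(SUP k\<in>{n..}. g k) + c"]) auto
    then have "g k + c \<le> (SUP k\<in>{n..}. g k + c)" if "n \<le> k" for k
      using that by (intro cSUP_upper[where f = "\<lambda>k. g k + c"]) auto
    then have "(SUP k\<in>{n..}. g k) \<le> (SUP k\<in>{n..}. g k + c) - c"
      by (intro cSUP_least) (auto simp: le_diff_eq)
    then show "(SUP k\<in>{n..}. g k) + c \<le> (SUP k\<in>{n..}. g k + c)" by simp
    show "(SUP k\<in>{n..}. g k + c) \<le> (SUP k\<in>{n..}. g k) + c"
      using le by (intro cSUP_least) auto
  qed
  have H_shift: "H (x + of_int m) = H x + of_int m" for x m
  proof -
    have "T (x + of_int m) = (\<lambda>n. T x n + of_int m)"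
      unfolding T_def a_shift using SUP_add[OF bdd] by auto
    then show ?thesis using LIMSEQ_unique[OF lim[of "x + of_int m"]] tendsto_add[OF lim[of x] tendsto_const] by metis
  qed
  have H_f: "H (f x) = H x + \<rho>" for x
  proof -
    have "T (f x) n = T x (Suc n) + \<rho>" for n
    proof -
      have *: "a (f x) k = a x (Suc k) + \<rho>" for k
        unfolding a_def by (simp add: funpow_swap1 algebra_simps)
      have "T (f x) n = (SUP k\<in>Suc ` {n..}. a x k + \<rho>)"
        unfolding T_def * by (simp only: image_image)
      also have "Suc ` {n..} = {Suc n..}"
        using image_add_atLeast[of 1 n] by (simp add: image_def)
      finally show ?thesis unfolding T_def using SUP_add[OF bdd] by simp
    qed
    then show ?thesis
      using LIMSEQ_unique[OF lim[of "f x"]] tendsto_add[OF LIMSEQ_Suc[OF lim[of x]] tendsto_const] 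
      by presburger
  qed
  have H_funpow: "H ((f ^^ n) x) = H x + real n * \<rho>" for n x
    by (induction n) (auto simp: H_f algebra_simps)
  \<comment> \<open>The values of \<open>H\<close> on one orbit and its integer translates are
    already dense, and a monotone function with dense range has no jumps.\<close>
  have dense: "\<exists>y. u < H y \<and> H y < v" if "u < v" for u v
  proof -
    have "u - H 0 < v - H 0" using that by simp
    then obtain n m where "u - H 0 < real n * \<rho> + of_int m" "real n * \<rho> + of_int m < v - H 0"
      by (rule dense_multiples[OF irr])
    then show ?thesis
      using H_funpow[of n 0] H_shift[of "(f ^^ n) 0" m] by (intro exI[of _ "(f ^^ n) 0 + of_int m"]) auto
  qed
  have "continuous_on UNIV H"
    unfolding continuous_on_iff dist_real_def
  proof clarify
    fix x e :: real assume "0 < e"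
    then obtain u v where uv: "H x - e < H u" "H u < H x" "H x < H v" "H v < H x + e"
      using dense[of "H x - e" "H x"] dense[of "H x" "H x + e"] by auto
    have u: "u < x" and v: "x < v" using uv monoD[OF H_mono] by (meson not_le)+
    show "\<exists>d>0. \<forall>x'\<in>UNIV. \<bar>x' - x\<bar> < d \<longrightarrow> \<bar>H x' - H x\<bar> < e"
    proof (intro exI[of _ "min (x - u) (v - x)"] conjI ballI impI)
      fix x' assume "\<bar>x' - x\<bar> < min (x - u) (v - x)"
      then have "u \<le> x'" "x' \<le> v" by auto
      then show "\<bar>H x' - H x\<bar> < e" using uv monoD[OF H_mono] by (smt (verit))
    qed (use u v in auto)
  qed
  then have "rotation_semiconjugacy f H \<rho>"
    using irr H_mono H_shift[of _ 1] H_f by unfold_locales auto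
  then show thesis by (rule that)
qed

context rotation_semiconjugacy
begin

sublocale HL: degree_one_lift H
  using H_cont H_mono H_shift1 by unfold_locales

lemma H_funpow: "H ((f ^^ n) x) = H x + real n * \<rho>"
  by (induction n) (auto simp: H_f algebra_simps)

lemma HL_surj: "\<exists>x. H x = t"
proof -
  define k where "k = \<lfloor>t - H 0\<rfloor>"
  have "H (of_int k) = H 0 + of_int k" "H (of_int (k + 1)) = H 0 + of_int (k + 1)"
    using HL.shift_int[of 0 k] HL.shift_int[of 0 "k + 1"] by simp_all
  then have "H (of_int k) \<le> t" "t \<le> H (of_int (k + 1))"
    unfolding k_def by linarith+
  then show ?thesis
    using IVT'[of H "of_int k" t "of_int (k + 1)"] H_cont
    by (metis continuous_on_subset subset_UNIV of_int_le_iff less_add_one less_imp_le)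
qed

section \<open>Fibres as compact intervals\<close>

definition lo :: "real \<Rightarrow> real" where "lo t = Inf {x. H x = t}"
definition hi :: "real \<Rightarrow> real" where "hi t = Sup {x. H x = t}"

lemma H_less_imp: "H x < H y \<Longrightarrow> x < y"
  using monoD[OF H_mono, of y x] by force

lemma fibre_bounds: "H x = t \<Longrightarrow> H y = t \<Longrightarrow> \<bar>x - y\<bar> \<le> 1"
  using H_less_imp[of x "y + 1"] H_less_imp[of y "x + 1"] H_shift1[of x] H_shift1[of y] by fastforce

lemma fibre_bdd: "bdd_above {x. H x = t}" "bdd_below {x. H x = t}"
proof -
  obtain y where y: "H y = t" using HL_surj by blast
  show "bdd_above {x. H x = t}" using fibre_bounds[OF _ y] by (intro bdd_aboveI[of _ "y + 1"]) fastforce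
  show "bdd_below {x. H x = t}" using fibre_bounds[OF _ y] by (intro bdd_belowI[of _ "y - 1"]) fastforce
qed

lemma fibre_closed: "closed {x. H x = t}"
  using continuous_closed_preimage_constant[OF H_cont closed_UNIV] by simp

lemma H_lo: "H (lo t) = t"
  using closed_contains_Inf[OF _ fibre_bdd(2) fibre_closed, of t] HL_surj unfolding lo_def by auto

lemma H_hi: "H (hi t) = t"
  using closed_contains_Sup[OF _ fibre_bdd(1) fibre_closed, of t] HL_surj unfolding hi_def by auto

lemma fibre_iff: "H x = t \<longleftrightarrow> lo t \<le> x \<and> x \<le> hi t"
proof
  assume "H x = t"
  then show "lo t \<le> x \<and> x \<le> hi t"
    unfolding lo_def hi_def by (auto intro: cInf_lower cSup_upper fibre_bdd)
next
  assume "lo t \<le> x \<and> x \<le> hi t"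
  then show "H x = t" using monoD[OF H_mono] H_lo H_hi by (metis antisym)
qed

lemma lo_le_hi: "lo t \<le> hi t"
  using fibre_iff H_lo by blast

lemma hi_less_lo: "s < t \<Longrightarrow> hi s < lo t"
  using H_less_imp H_lo H_hi by simp

lemma lo_mono: "s \<le> t \<Longrightarrow> lo s \<le> lo t"
  using hi_less_lo[of s t] lo_le_hi[of s] by (cases "s = t") auto

lemma lo_eqI: "H x = t \<Longrightarrow> (\<And>y. H y = t \<Longrightarrow> x \<le> y) \<Longrightarrow> lo t = x"
  using fibre_iff[of x t] H_lo[of t] by (intro antisym) auto

lemma hi_eqI: "H x = t \<Longrightarrow> (\<And>y. H y = t \<Longrightarrow> y \<le> x) \<Longrightarrow> hi t = x"
  using fibre_iff[of x t] H_hi[of t] by (intro antisym) auto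

lemma lo_shift: "lo (t + of_int k) = lo t + of_int k"
proof (rule lo_eqI)
  fix y assume "H y = t + of_int k"
  then have "H (y + of_int (- k)) = t" using HL.shift_int[of y "- k"] by simp
  then have "lo t \<le> y + of_int (- k)" using fibre_iff by blast
  then show "lo t + of_int k \<le> y" by simp
qed (simp add: HL.shift_int H_lo)

lemma hi_shift: "hi (t + of_int k) = hi t + of_int k"
proof (rule hi_eqI)
  fix y assume "H y = t + of_int k"
  then have "H (y + of_int (- k)) = t" using HL.shift_int[of y "- k"] by simp
  then have "y + of_int (- k) \<le> hi t" using fibre_iff by blast
  then show "y \<le> hi t + of_int k" by simp
qed (simp add: HL.shift_int H_hi)

section \<open>Action of the lift on fibres\<close>

lemma f_surj: "\<exists>x. f x = y"
proof -
  define k where "k = \<lfloor>y - f 0\<rfloor>"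
  have "f (of_int k) = f 0 + of_int k" "f (of_int (k + 1)) = f 0 + of_int (k + 1)"
    using shift_int[of 0 k] shift_int[of 0 "k + 1"] by simp_all
  then have "f (of_int k) \<le> y" "y \<le> f (of_int (k + 1))"
    unfolding k_def by linarith+
  then show ?thesis
    using IVT'[of f "of_int k" y "of_int (k + 1)"] cont
    by (metis continuous_on_subset subset_UNIV of_int_le_iff less_add_one less_imp_le)
qed

lemma fibre_image: "H y = t + \<rho> \<Longrightarrow> \<exists>x. H x = t \<and> f x = y"
  using f_surj[of y] H_f by fastforce

text \<open>A monotone map of one fibre onto another matches their endpoints, even where it is not
  injective.\<close>

lemma f_lo: "f (lo t) = lo (t + \<rho>)"
proof (rule lo_eqI[symmetric])
  fix y assume "H y = t + \<rho>"
  then obtain x where "H x = t" "f x = y" using fibre_image by blast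
  then show "f (lo t) \<le> y" using fibre_iff monoD[OF mono_f] by blast
qed (simp add: H_f H_lo)

lemma f_hi: "f (hi t) = hi (t + \<rho>)"
proof (rule hi_eqI[symmetric])
  fix y assume "H y = t + \<rho>"
  then obtain x where "H x = t" "f x = y" using fibre_image by blast
  then show "y \<le> f (hi t)" using fibre_iff monoD[OF mono_f] by blast
qed (simp add: H_f H_hi)

text \<open>By monotonicity of \<open>lo\<close> the intervals \<open>[lo s, lo (s + D)]\<close> do
  not overlap. Using \<open>lo\<close> at both ends keeps this true where \<open>lo\<close>
  jumps.\<close>

lemma separated_increments:
  assumes "finite S" "S \<noteq> {}"
    "\<And>s s'. s \<in> S \<Longrightarrow> s' \<in> S \<Longrightarrow> s < s' \<Longrightarrow> s + D \<le> s'" "\<And>s. s \<in> S \<Longrightarrow> u \<le> s \<and> s + D \<le> v"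
  shows "(\<Sum>s\<in>S. lo (s + D) - lo s) \<le> lo v - lo u"
  using assms
proof (induction "card S" arbitrary: S v)
  case (Suc n)
  define x where "x = Max S"
  have x: "x \<in> S" "\<And>s. s \<in> S \<Longrightarrow> s \<le> x" using Suc.prems unfolding x_def by auto
  show ?case
  proof (cases "S = {x}")
    case True
    then show ?thesis using Suc.prems(4)[of x] lo_mono[of "x + D" v] lo_mono[of u x] by simp
  next
    case False
    have "(\<Sum>s\<in>S - {x}. lo (s + D) - lo s) \<le> lo x - lo u"
    proof (rule Suc.hyps(1))
      show "n = card (S - {x})" using Suc.hyps(2) x Suc.prems(1) by simp
      show "s + D \<le> s'" if "s \<in> S - {x}" "s' \<in> S - {x}" "s < s'" for s s'
        using that Suc.prems(3) by blast
      show "u \<le> s \<and> s + D \<le> x" if "s \<in> S - {x}" for s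
        using that Suc.prems(3)[of s x] Suc.prems(4)[of s] x by (auto simp: less_le)
    qed (use Suc.prems False x in auto)
    then show ?thesis
      using sum.remove[OF Suc.prems(1) x(1), of "\<lambda>s. lo (s + D) - lo s"]
        lo_mono[of "x + D" v] Suc.prems(4)[OF x(1)] by simp
  qed
qed simp

lemma separated_increments_circle:
  fixes t :: "nat \<Rightarrow> real"
  assumes "0 < Q" "0 < D"
    and sep: "\<And>i j m. i < Q \<Longrightarrow> j < Q \<Longrightarrow> i \<noteq> j \<Longrightarrow> D \<le> \<bar>t i - t j - of_int m\<bar>"
    and "D \<le> 1"
  shows "(\<Sum>i<Q. lo (t i + D) - lo (t i)) \<le> 1"
proof -
  define S where "S = (\<lambda>i. frac (t i)) ` {..<Q}"
  have inj: "inj_on (\<lambda>i. frac (t i)) {..<Q}"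
  proof (rule inj_onI, rule ccontr)
    fix i j assume ij: "i \<in> {..<Q}" "j \<in> {..<Q}" "frac (t i) = frac (t j)" "i \<noteq> j"
    then have "t i - t j - of_int (\<lfloor>t i\<rfloor> - \<lfloor>t j\<rfloor>) = 0" by (simp add: frac_def)
    then show False using sep[of i j "\<lfloor>t i\<rfloor> - \<lfloor>t j\<rfloor>"] ij \<open>0 < D\<close> by auto
  qed
  \<comment> \<open>Using the separation with \<open>m\<close> and with \<open>m + 1\<close> also
    covers the wrap-around, which lets all of \<open>S\<close> fit between \<open>u\<close> and
    \<open>u + 1\<close>.\<close>
  have sepS: "s + D \<le> s' \<and> s' + D \<le> s + 1" if "s \<in> S" "s' \<in> S" "s < s'" for s s'
  proof -
    from that obtain i j where ij: "i < Q" "j < Q" "s = frac (t i)" "s' = frac (t j)"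
      unfolding S_def by blast
    then have "j \<noteq> i" using that by auto
    define m where "m = \<lfloor>t j\<rfloor> - \<lfloor>t i\<rfloor>"
    have "t j - t i - of_int m = s' - s" unfolding ij m_def frac_def by simp
    then have "D \<le> \<bar>s' - s\<bar>" "D \<le> \<bar>s' - s - 1\<bar>"
      using sep[of j i m] sep[of j i "m + 1"] ij \<open>j \<noteq> i\<close> by (auto simp: algebra_simps)
    moreover have "s' < 1" "0 \<le> s" unfolding ij by (simp_all add: frac_lt_1)
    ultimately show ?thesis using that(3) by linarith
  qed
  have fin: "finite S" "S \<noteq> {}" using \<open>0 < Q\<close> unfolding S_def by auto
  define u where "u = Min S"
  have u: "u \<in> S" "\<And>s. s \<in> S \<Longrightarrow> u \<le> s" using fin unfolding u_def by auto
  have "(\<Sum>i<Q. lo (t i + D) - lo (t i)) = (\<Sum>i<Q. lo (frac (t i) + D) - lo (frac (t i)))"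
    using lo_shift[of _ "- \<lfloor>t _\<rfloor>"]
    by (intro sum.cong refl) (simp add: frac_def algebra_simps lo_shift[of _ "- \<lfloor>t _\<rfloor>", simplified])
  also have "\<dots> = (\<Sum>s\<in>S. lo (s + D) - lo s)"
    unfolding S_def by (simp add: sum.reindex[OF inj])
  also have "\<dots> \<le> lo (u + 1) - lo u"
  proof (rule separated_increments[OF fin])
    show "u \<le> s \<and> s + D \<le> u + 1" if "s \<in> S" for s
      using sepS[OF u(1) that] u(2)[OF that] \<open>D \<le> 1\<close> by (cases "s = u") auto
  qed (use sepS in auto)
  also have "\<dots> = 1" using lo_shift[of u 1] by simp
  finally show ?thesis .
qed

text \<open>
  The intervals over \<open>[t\<^sub>i + jD, t\<^sub>i + (j+1)D]\<close>, with \<open>j\<close> fixed, do not overlap modulo 1, and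
  the five values \<open>-2 \<le> j \<le> 2\<close> suffice.
\<close>

lemma separated_total_length:
  fixes t :: "nat \<Rightarrow> real"
  assumes "0 < Q" "0 < D"
    and sep: "\<And>i j m. i < Q \<Longrightarrow> j < Q \<Longrightarrow> i \<noteq> j \<Longrightarrow> D \<le> \<bar>t i - t j - of_int m\<bar>"
    and "D \<le> 1" "x \<le> 2 * D" "y \<le> 2 * D"
  shows "(\<Sum>i<Q. hi (t i + y) - lo (t i - x)) \<le> 5"
proof -
  have one: "(\<Sum>i<Q. lo (t i + c + D) - lo (t i + c)) \<le> 1" for c
    using separated_increments_circle[of Q D "\<lambda>i. t i + c"] assms(1-4) by simp
  have "hi (t i + y) - lo (t i - x)
      \<le> (lo (t i + 2 * D + D) - lo (t i + 2 * D)) + (lo (t i + D + D) - lo (t i + D))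
        + (lo (t i + 0 + D) - lo (t i + 0)) + (lo (t i + (- D) + D) - lo (t i + (- D)))
        + (lo (t i + (- 2 * D) + D) - lo (t i + (- 2 * D)))" for i
  proof -
    \<comment> \<open>The strict inequality \<open>y < 3 * D\<close> allows the passage from
      \<open>hi\<close> to \<open>lo\<close>: the topmost fibre with its full length is covered by
      the block from \<open>2 * D\<close> to \<open>3 * D\<close>.\<close>
    have "hi (t i + y) \<le> lo (t i + 2 * D + D)"
      using hi_less_lo[of "t i + y" "t i + 2 * D + D"] assms by simp
    moreover have "lo (t i + (- 2 * D)) \<le> lo (t i - x)"
      using assms by (intro lo_mono) simp
    moreover have "lo (t i + D + D) = lo (t i + 2 * D)" "lo (t i + 0 + D) = lo (t i + D)"
      "lo (t i + (- D) + D) = lo (t i + 0)" "lo (t i + (- 2 * D) + D) = lo (t i + (- D))"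
      by (rule arg_cong[where f = lo], simp)+
    ultimately show ?thesis by linarith
  qed
  then have "(\<Sum>i<Q. hi (t i + y) - lo (t i - x))
      \<le> (\<Sum>i<Q. (lo (t i + 2 * D + D) - lo (t i + 2 * D)) + (lo (t i + D + D) - lo (t i + D))
        + (lo (t i + 0 + D) - lo (t i + 0)) + (lo (t i + (- D) + D) - lo (t i + (- D)))
        + (lo (t i + (- 2 * D) + D) - lo (t i + (- 2 * D))))"
    by (rule sum_mono)
  also have "\<dots> \<le> 5"
    using one[of "2 * D"] one[of D] one[of 0] one[of "- D"] one[of "- 2 * D"]
    unfolding sum.distrib by simp
  finally show ?thesis .
qed

end

section \<open>Cross-ratios\<close>

text \<open>The interval is \<open>[b, c]\<close>, with gaps \<open>[a, b]\<close> and
  \<open>[c, d]\<close>. The value is small when one gap is short relative to the interval.\<close>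

definition cross_ratio :: "real \<Rightarrow> real \<Rightarrow> real \<Rightarrow> real \<Rightarrow> real" where
  "cross_ratio a b c d = (b - a) * (d - c) / ((c - a) * (d - b))"

lemma cross_ratio_mirror: "cross_ratio (- d) (- c) (- b) (- a) = cross_ratio a b c d"
  unfolding cross_ratio_def by (simp add: mult.commute)

lemma cross_ratio_shift: "cross_ratio (a + k) (b + k) (c + k) (d + k) = cross_ratio a b c d"
  unfolding cross_ratio_def by simp

lemma cross_ratio_pos: "a < b \<Longrightarrow> b < c \<Longrightarrow> c < d \<Longrightarrow> 0 < cross_ratio a b c d"
  unfolding cross_ratio_def by simp

text \<open>The numerator \<open>w\<close> of the derivative vanishes at 0, and its own derivative
  is \<open>(p^2 - 1) * sinh (p * s) * sinh s\<close>, which is nonnegative.\<close>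

lemma sinh_ratio_mono:
  fixes p x y :: real
  assumes "1 \<le> p" "0 < x" "x \<le> y"
  shows "sinh (p * x) / sinh x \<le> sinh (p * y) / sinh y"
proof (rule DERIV_nonneg_imp_nondecreasing[OF assms(3), where f = "\<lambda>t. sinh (p * t) / sinh t"])
  fix t assume "x \<le> t"
  then have t: "0 < t" using assms by simp
  define w where "w s = p * cosh (p * s) * sinh s - sinh (p * s) * cosh s" for s :: real
  have "w 0 \<le> w t"
  proof (rule DERIV_nonneg_imp_nondecreasing[where f = w])
    fix s :: real assume "0 \<le> s"
    have "(w has_real_derivative (p\<^sup>2 - 1) * (sinh (p * s) * sinh s)) (at s)"
      unfolding w_def by (auto intro!: derivative_eq_intros simp: algebra_simps power2_eq_square)
    moreover have "0 \<le> (p\<^sup>2 - 1) * (sinh (p * s) * sinh s)"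
      using assms(1) \<open>0 \<le> s\<close> by (intro mult_nonneg_nonneg) (auto simp: power2_eq_square mult_ge1_I)
    ultimately show "\<exists>y. (w has_real_derivative y) (at s) \<and> 0 \<le> y" by blast
  qed (use t in simp)
  then have "0 \<le> w t" by (simp add: w_def)
  have "((\<lambda>t. sinh (p * t) / sinh t) has_real_derivative w t / (sinh t)\<^sup>2) (at t)"
    using t unfolding w_def
    by (auto intro!: derivative_eq_intros simp: algebra_simps power2_eq_square)
  with \<open>0 \<le> w t\<close> show "\<exists>y. ((\<lambda>t. sinh (p * t) / sinh t) has_real_derivative y) (at t) \<and> 0 \<le> y"
    by (meson divide_nonneg_nonneg zero_le_power2)
qed

text \<open>A difference of exponentials is a sinh times an exponential, and the exponential factors
  cancel. The 2 in the exponents avoids halves inside sinh.\<close>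

lemma cross_ratio_exp:
  "cross_ratio (exp (2 * A)) (exp (2 * B)) (exp (2 * C)) (exp (2 * D))
     = sinh (B - A) * sinh (D - C) / (sinh (C - A) * sinh (D - B))"
proof -
  have *: "exp (2 * v) - exp (2 * u) = 2 * exp (u + v) * sinh (v - u)" for u v :: real
    by (simp add: sinh_def algebra_simps flip: exp_add)
  have "cross_ratio (exp (2 * A)) (exp (2 * B)) (exp (2 * C)) (exp (2 * D))
     = ((2 * exp (A + B)) * (2 * exp (C + D))) * (sinh (B - A) * sinh (D - C))
       / (((2 * exp (A + C)) * (2 * exp (B + D))) * (sinh (C - A) * sinh (D - B)))"
    unfolding cross_ratio_def * by (simp only: mult_ac)
  also have "(2 * exp (A + B)) * (2 * exp (C + D)) = (2 * exp (A + C)) * (2 * exp (B + D))"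
    by (simp add: algebra_simps flip: exp_add)
  finally show ?thesis by simp
qed

text \<open>In logarithmic coordinates the power is multiplication by \<open>p\<close>, and the
  cross-ratio is a product of two quotients, sinh of a part over sinh of the whole; by
  \<open>sinh_ratio_mono\<close> neither grows under the dilation.\<close>

lemma cross_ratio_powr:
  fixes p :: real
  assumes "1 \<le> p" "0 < a" "a < b" "b < c" "c < d"
  shows "cross_ratio (a powr p) (b powr p) (c powr p) (d powr p) \<le> cross_ratio a b c d"
proof -
  define L where "L x = ln x / 2" for x :: real
  have e: "x = exp (2 * L x)" "x powr p = exp (2 * (p * L x))" if "0 < x" for x
    using that by (simp_all add: L_def powr_def)
  have L: "L a < L b" "L b < L c" "L c < L d" using assms unfolding L_def by simp_all
  have ratio: "sinh (p * x) / sinh (p * y) \<le> sinh x / sinh y" if "0 < x" "x \<le> y" for x y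
  proof -
    have "0 < sinh x" "0 < sinh y" "0 < sinh (p * y)" using that assms(1) by simp_all
    then show ?thesis
      using sinh_ratio_mono[OF assms(1) that] by (simp add: field_simps del: sinh_real_pos_iff)
  qed
  have "cross_ratio (a powr p) (b powr p) (c powr p) (d powr p)
      = sinh (p * (L b - L a)) / sinh (p * (L c - L a)) * (sinh (p * (L d - L c)) / sinh (p * (L d - L b)))"
    using assms by (simp add: e(2) cross_ratio_exp right_diff_distrib del: powr_less_cancel_iff)
  also have "\<dots> \<le> sinh (L b - L a) / sinh (L c - L a) * (sinh (L d - L c) / sinh (L d - L b))"
    using L assms(1) by (intro mult_mono ratio) auto
  also have "\<dots> = cross_ratio (exp (2 * L a)) (exp (2 * L b)) (exp (2 * L c)) (exp (2 * L d))"
    by (simp add: cross_ratio_exp)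
  also have "\<dots> = cross_ratio a b c d"
    using assms by (simp flip: e(1))
  finally show ?thesis .
qed

text \<open>This bound and the upper one that follows carry the same weight
  \<open>v powr (p - 1)\<close>, taken at the right end. It cancels in quotients of increments,
  which therefore stay controlled down to the singular point 0.\<close>

lemma powr_diff_lower:
  fixes p :: real
  assumes "1 \<le> p" "0 \<le> u" "u < v"
  shows "v powr (p - 1) * (v - u) \<le> v powr p - u powr p"
proof -
  have m: "x powr p = x powr (p - 1) * x" if "0 \<le> x" for x
    using that by (cases "x = 0") (auto simp: powr_diff)
  have "u powr (p - 1) * u \<le> v powr (p - 1) * u"
    using assms by (intro mult_right_mono powr_mono2) auto
  then show ?thesis using assms m[of u] m[of v] by (simp add: algebra_simps)
qed

lemma powr_diff_upper:
  fixes p :: real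
  assumes "1 \<le> p" "0 \<le> u" "u < v"
  shows "v powr p - u powr p \<le> p * v powr (p - 1) * (v - u)"
proof (cases "u = 0")
  case True
  have "v powr p = v powr (p - 1) * v" using assms by (simp add: powr_diff)
  moreover have "v powr (p - 1) * v * 1 \<le> v powr (p - 1) * v * p"
    using assms by (intro mult_left_mono) auto
  ultimately show ?thesis using True by (simp add: mult_ac)
next
  case False
  have "\<exists>z>u. z < v \<and> v powr p - u powr p = (v - u) * (p * z powr (p - 1))"
    using assms False by (intro MVT2) (auto intro!: derivative_eq_intros)
  then obtain z where z: "u < z" "z < v" "v powr p - u powr p = (v - u) * (p * z powr (p - 1))" by blast
  have "(v - u) * (p * z powr (p - 1)) \<le> (v - u) * (p * v powr (p - 1))"
    using z assms by (intro mult_left_mono powr_mono2) auto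
  then show ?thesis using z by (simp add: mult_ac)
qed

text \<open>What one monotone piece contributes to \<open>bounded_distortion\<close>. The
  cross-ratio clause serves short quadruples and leaves out the ends, because
  \<open>cross_ratio_powr\<close> takes logarithms of its arguments. The clauses on ratios and
  increments include the ends; glued over all pieces they give the cruder bound for long
  quadruples.\<close>

definition tame :: "(real \<Rightarrow> real) \<Rightarrow> real \<Rightarrow> real \<Rightarrow> real \<Rightarrow> bool" where
  "tame f s t C \<longleftrightarrow>
     (\<forall>a b c d. s < a \<and> a < b \<and> b < c \<and> c < d \<and> d < t \<longrightarrow>
        cross_ratio (f a) (f b) (f c) (f d) \<le> exp (C * (d - a)) * cross_ratio a b c d) \<and>
     (\<forall>a b c. s \<le> a \<and> a < b \<and> b < c \<and> c \<le> t \<longrightarrow>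
        (f b - f a) * (c - a) \<le> C * ((f c - f a) * (b - a)) \<and>
        (f c - f b) * (c - a) \<le> C * ((f c - f a) * (c - b))) \<and>
     (\<forall>a b. s \<le> a \<and> a < b \<and> b \<le> t \<longrightarrow> f b - f a \<le> C * (b - a))"

lemma tameD:
  assumes "tame f s t C"
  shows "s < a \<Longrightarrow> a < b \<Longrightarrow> b < c \<Longrightarrow> c < d \<Longrightarrow> d < t \<Longrightarrow>
      cross_ratio (f a) (f b) (f c) (f d) \<le> exp (C * (d - a)) * cross_ratio a b c d"
    and "s \<le> a \<Longrightarrow> a < b \<Longrightarrow> b < c \<Longrightarrow> c \<le> t \<Longrightarrow> (f b - f a) * (c - a) \<le> C * ((f c - f a) * (b - a))"
    and "s \<le> a \<Longrightarrow> a < b \<Longrightarrow> b < c \<Longrightarrow> c \<le> t \<Longrightarrow> (f c - f b) * (c - a) \<le> C * ((f c - f a) * (c - b))"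
    and "s \<le> a \<Longrightarrow> a < b \<Longrightarrow> b \<le> t \<Longrightarrow> f b - f a \<le> C * (b - a)"
  using assms unfolding tame_def by blast+

lemma tameI:
  assumes "\<And>a b c d. s < a \<Longrightarrow> a < b \<Longrightarrow> b < c \<Longrightarrow> c < d \<Longrightarrow> d < t \<Longrightarrow>
      cross_ratio (f a) (f b) (f c) (f d) \<le> exp (C * (d - a)) * cross_ratio a b c d"
    and "\<And>a b c. s \<le> a \<Longrightarrow> a < b \<Longrightarrow> b < c \<Longrightarrow> c \<le> t \<Longrightarrow> (f b - f a) * (c - a) \<le> C * ((f c - f a) * (b - a))"
    and "\<And>a b c. s \<le> a \<Longrightarrow> a < b \<Longrightarrow> b < c \<Longrightarrow> c \<le> t \<Longrightarrow> (f c - f b) * (c - a) \<le> C * ((f c - f a) * (c - b))"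
    and "\<And>a b. s \<le> a \<Longrightarrow> a < b \<Longrightarrow> b \<le> t \<Longrightarrow> f b - f a \<le> C * (b - a)"
  shows "tame f s t C"
  using assms unfolding tame_def by blast

text \<open>Reflection exchanges the two ends, so that only a singularity at the left end of a piece
  needs a direct estimate.\<close>

lemma tame_mirror:
  assumes "tame f s t C"
  shows "tame (\<lambda>x. - f (- x)) (- t) (- s) C"
proof (rule tameI)
  fix a b c d assume "- t < a" "a < b" "b < c" "c < d" "d < - s"
  then show "cross_ratio (- f (- a)) (- f (- b)) (- f (- c)) (- f (- d))
              \<le> exp (C * (d - a)) * cross_ratio a b c d"
    using tameD(1)[OF assms, of "- d" "- c" "- b" "- a"] by (simp add: cross_ratio_mirror)
next
  fix a b c assume *: "- t \<le> a" "a < b" "b < c" "c \<le> - s"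
  show "(- f (- b) - - f (- a)) * (c - a) \<le> C * ((- f (- c) - - f (- a)) * (b - a))"
    using tameD(3)[OF assms, of "- c" "- b" "- a"] * by (simp add: algebra_simps)
  show "(- f (- c) - - f (- b)) * (c - a) \<le> C * ((- f (- c) - - f (- a)) * (c - b))"
    using tameD(2)[OF assms, of "- c" "- b" "- a"] * by (simp add: algebra_simps)
next
  fix a b assume "- t \<le> a" "a < b" "b \<le> - s"
  then show "- f (- b) - - f (- a) \<le> C * (b - a)" using tameD(4)[OF assms, of "- b" "- a"] by simp
qed

lemma tame_constant_mono:
  assumes tame: "tame f s t C" and C: "C \<le> C'" and "mono f"
  shows "tame f s t C'"
proof (rule tameI)
  fix a b c d assume *: "s < a" "a < b" "b < c" "c < d" "d < t"
  have "cross_ratio (f a) (f b) (f c) (f d) \<le> exp (C * (d - a)) * cross_ratio a b c d"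
    using tameD(1)[OF tame *] .
  also have "\<dots> \<le> exp (C' * (d - a)) * cross_ratio a b c d"
    using * C less_imp_le[OF cross_ratio_pos[of a b c d]]
    by (intro mult_right_mono) (auto intro!: mult_right_mono)
  finally show "cross_ratio (f a) (f b) (f c) (f d) \<le> exp (C' * (d - a)) * cross_ratio a b c d" .
next
  fix a b c assume *: "s \<le> a" "a < b" "b < c" "c \<le> t"
  have le: "C * ((f c - f a) * w) \<le> C' * ((f c - f a) * w)" if "0 \<le> w" for w
    using C monoD[OF \<open>mono f\<close>, of a c] * that by (intro mult_right_mono) auto
  show "(f b - f a) * (c - a) \<le> C' * ((f c - f a) * (b - a))"
    by (rule order_trans[OF tameD(2)[OF tame *] le]) (use * in simp)
  show "(f c - f b) * (c - a) \<le> C' * ((f c - f a) * (c - b))"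
    by (rule order_trans[OF tameD(3)[OF tame *] le]) (use * in simp)
next
  fix a b assume *: "s \<le> a" "a < b" "b \<le> t"
  have "C * (b - a) \<le> C' * (b - a)" using C * by (intro mult_right_mono) auto
  then show "f b - f a \<le> C' * (b - a)" by (rule order_trans[OF tameD(4)[OF tame *]])
qed

text \<open>Two regimes at once: \<open>s = 0\<close> is the power law next to the flat interval,
  \<open>p = 1\<close> with \<open>s > 0\<close> a regular piece. The bound \<open>r \<le> 1\<close>
  keeps the weights \<open>d powr (p - 1)\<close> below 1.\<close>

lemma tame_power_piece:
  fixes h h' :: "real \<Rightarrow> real" and p :: real
  assumes p: "1 \<le> p" and s: "0 \<le> s" "s < r" "r \<le> 1"
    and h: "\<And>z. s powr p \<le> z \<Longrightarrow> z \<le> r powr p \<Longrightarrow> (h has_real_derivative h' z) (at z)"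
    and m: "0 < m" "\<And>z. s powr p \<le> z \<Longrightarrow> z \<le> r powr p \<Longrightarrow> m \<le> h' z \<and> h' z \<le> M"
    and L: "0 \<le> L" "\<And>y z. s powr p \<le> y \<Longrightarrow> y \<le> r powr p \<Longrightarrow> s powr p \<le> z \<Longrightarrow> z \<le> r powr p \<Longrightarrow>
                 \<bar>h' y - h' z\<bar> \<le> L * \<bar>y - z\<bar>"
    and f: "\<And>x. u + s \<le> x \<Longrightarrow> x \<le> u + r \<Longrightarrow> f x = h ((x - u) powr p)"
  obtains C where "0 \<le> C" "tame f (u + s) (u + r) C"
proof -
  have rp: "s powr p \<le> x powr p \<and> x powr p \<le> r powr p" if "s \<le> x" "x \<le> r" for x
    using that s p by (auto intro!: powr_mono2)
  have mM: "m \<le> M" using m(2)[of "s powr p"] rp[of s] s by force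
  have mvt: "\<exists>\<xi>>y. \<xi> < z \<and> h z - h y = (z - y) * h' \<xi>" if "s powr p \<le> y" "y < z" "z \<le> r powr p" for y z
    using that by (intro MVT2 h) auto
  have pw_less: "x powr p < y powr p" if "s \<le> x" "x < y" for x y
    using that s p by (intro powr_less_mono2) auto
  have f_diff: "f (u + y) - f (u + x) \<le> M * (y powr p - x powr p) \<and> m * (y powr p - x powr p) \<le> f (u + y) - f (u + x)"
    if xy: "s \<le> x" "x < y" "y \<le> r" for x y
  proof -
    obtain \<xi> where \<xi>: "x powr p < \<xi>" "\<xi> < y powr p"
      "h (y powr p) - h (x powr p) = (y powr p - x powr p) * h' \<xi>"
      using mvt[of "x powr p" "y powr p"] rp[of x] rp[of y] pw_less xy by force
    have "m \<le> h' \<xi>" "h' \<xi> \<le> M" using m(2)[of \<xi>] \<xi> rp[of x] rp[of y] xy by auto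
    then have "(y powr p - x powr p) * h' \<xi> \<le> (y powr p - x powr p) * M"
      "(y powr p - x powr p) * m \<le> (y powr p - x powr p) * h' \<xi>"
      using \<xi> by (intro mult_left_mono; simp)+
    then show ?thesis using f[of "u + x"] f[of "u + y"] xy \<xi>(3) by (simp add: mult.commute)
  qed
  \<comment> \<open>A Lipschitz constant for the logarithm of \<open>h'\<close>, since
    \<open>h'\<close> is at least \<open>m\<close>.\<close>
  define \<Lambda> where "\<Lambda> = L / m"
  have \<Lambda>: "0 \<le> \<Lambda>" using L m unfolding \<Lambda>_def by simp
  have dist: "h' y \<le> exp (\<Lambda> * \<delta>) * h' z"
    if "s powr p \<le> y" "y \<le> r powr p" "s powr p \<le> z" "z \<le> r powr p" "\<bar>y - z\<bar> \<le> \<delta>" for y z \<delta>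
  proof -
    have hz: "m \<le> h' z" using m(2) that by blast
    have "h' y \<le> h' z + L * \<bar>y - z\<bar>" using L(2)[of y z] that by linarith
    also have "\<dots> \<le> h' z + L * \<delta>" using that L(1) by (simp add: mult_left_mono)
    also have "L * \<delta> = \<Lambda> * \<delta> * m" using m by (simp add: \<Lambda>_def)
    also have "\<dots> \<le> \<Lambda> * \<delta> * h' z" using hz \<Lambda> that by (intro mult_left_mono) auto
    also have "h' z + \<Lambda> * \<delta> * h' z = (1 + \<Lambda> * \<delta>) * h' z" by (simp add: algebra_simps)
    also have "\<dots> \<le> exp (\<Lambda> * \<delta>) * h' z" using hz m by (intro mult_right_mono) auto
    finally show ?thesis by simp
  qed
  have cr: "cross_ratio (f (u + a)) (f (u + b)) (f (u + c)) (f (u + d))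
              \<le> exp (2 * \<Lambda> * p * (d - a)) * cross_ratio a b c d"
    if *: "s < a" "a < b" "b < c" "c < d" "d < r" for a b c d
  proof -
    define A B C' D where "A = a powr p" "B = b powr p" "C' = c powr p" "D = d powr p"
    have o: "s powr p \<le> A" "A < B" "B < C'" "C' < D" "D \<le> r powr p"
      using rp[of a] rp[of d] pw_less * unfolding A_B_C'_D_def by auto
    \<comment> \<open>Each difference in the cross-ratio becomes a value of \<open>h'\<close>. Two
      such values stand in the numerator and two in the denominator, so pairing \<open>x1\<close>
      with \<open>x3\<close> and \<open>x2\<close> with \<open>x4\<close> costs one factor
      \<open>E\<close> per pair.\<close>
    obtain x1 where x1: "A < x1" "x1 < B" "h B - h A = (B - A) * h' x1" using mvt[of A B] o by auto
    obtain x2 where x2: "C' < x2" "x2 < D" "h D - h C' = (D - C') * h' x2" using mvt[of C' D] o by auto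
    obtain x3 where x3: "A < x3" "x3 < C'" "h C' - h A = (C' - A) * h' x3" using mvt[of A C'] o by auto
    obtain x4 where x4: "B < x4" "x4 < D" "h D - h B = (D - B) * h' x4" using mvt[of B D] o by auto
    have pos: "0 < h' x3" "0 < h' x4" "0 < h' x2" "0 < h' x1"
      using m(1) m(2)[of x1] m(2)[of x2] m(2)[of x3] m(2)[of x4] x1 x2 x3 x4 o by linarith+
    define E where "E = exp (\<Lambda> * (D - A))"
    have "h' x1 \<le> E * h' x3" "h' x2 \<le> E * h' x4"
      unfolding E_def using x1 x2 x3 x4 o by (intro dist; linarith)+
    then have q: "h' x1 * h' x2 \<le> (E * h' x3) * (E * h' x4)"
      using pos by (intro mult_mono) (auto simp: E_def)
    have "cross_ratio (h A) (h B) (h C') (h D) = cross_ratio A B C' D * ((h' x1 * h' x2) / (h' x3 * h' x4))"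
      unfolding cross_ratio_def x1(3) x2(3) x3(3) x4(3) using pos o by (simp add: field_simps)
    also have "\<dots> \<le> cross_ratio A B C' D * (E * E)"
    proof (rule mult_left_mono)
      show "h' x1 * h' x2 / (h' x3 * h' x4) \<le> E * E"
        using q pos by (simp add: divide_le_eq mult_ac)
      show "0 \<le> cross_ratio A B C' D" using o by (intro less_imp_le cross_ratio_pos)
    qed
    also have "\<dots> \<le> cross_ratio a b c d * (E * E)"
      using cross_ratio_powr[OF p, of a b c d] * s unfolding A_B_C'_D_def
      by (intro mult_right_mono) (auto simp: E_def)
    also have "\<dots> \<le> cross_ratio a b c d * exp (2 * \<Lambda> * p * (d - a))"
    proof (rule mult_left_mono)
      have "D - A \<le> p * d powr (p - 1) * (d - a)"
        using powr_diff_upper[of p a d] p * s unfolding A_B_C'_D_def by simp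
      also have "\<dots> \<le> p * 1 * (d - a)"
        using p * s powr_mono2[of "p - 1" d 1] by (intro mult_right_mono mult_left_mono) auto
      finally have "\<Lambda> * (D - A) \<le> \<Lambda> * (p * (d - a))" using \<Lambda> by (intro mult_left_mono) auto
      then show "E * E \<le> exp (2 * \<Lambda> * p * (d - a))" unfolding E_def by (simp flip: exp_add)
      show "0 \<le> cross_ratio a b c d" using * by (intro less_imp_le cross_ratio_pos)
    qed
    finally show ?thesis
      using f[of "u + a"] f[of "u + b"] f[of "u + c"] f[of "u + d"] * s
      unfolding A_B_C'_D_def by (simp add: mult.commute)
  qed
  have Mp: "0 \<le> M * p" using mM m p by simp
  have up: "f (u + y) - f (u + x) \<le> M * p * (y powr (p - 1) * (y - x))" if "s \<le> x" "x < y" "y \<le> r" for x y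
  proof -
    have "f (u + y) - f (u + x) \<le> M * (y powr p - x powr p)" using f_diff that by blast
    also have "\<dots> \<le> M * (p * y powr (p - 1) * (y - x))"
      using powr_diff_upper[OF p, of x y] that s mM m by (intro mult_left_mono) auto
    finally show ?thesis by (simp add: mult_ac)
  qed
  have ratio: "(f (u + y) - f (u + x)) * (c - a) \<le> (M * p / m) * ((f (u + c) - f (u + a)) * (y - x))"
    if *: "s \<le> a" "a < c" "c \<le> r" "a \<le> x" "x < y" "y \<le> c" for a c x y
  proof -
    have "m * (c powr (p - 1) * (c - a)) \<le> m * (c powr p - a powr p)"
      using powr_diff_lower[OF p, of a c] * s m by (intro mult_left_mono) auto
    also have "\<dots> \<le> f (u + c) - f (u + a)" using f_diff * by blast
    finally have low: "m * (c powr (p - 1) * (c - a)) \<le> f (u + c) - f (u + a)" .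
    have "f (u + y) - f (u + x) \<le> M * p * (y powr (p - 1) * (y - x))" using up * by auto
    also have "\<dots> \<le> M * p * (c powr (p - 1) * (y - x))"
      using * s p Mp by (intro mult_left_mono mult_right_mono powr_mono2) auto
    finally have "(f (u + y) - f (u + x)) * (c - a) \<le> M * p * (c powr (p - 1) * (y - x)) * (c - a)"
      using * by (intro mult_right_mono) auto
    also have "\<dots> = (M * p / m) * ((m * (c powr (p - 1) * (c - a))) * (y - x))"
      using m by (simp add: mult_ac)
    also have "\<dots> \<le> (M * p / m) * ((f (u + c) - f (u + a)) * (y - x))"
      using low Mp m * by (intro mult_left_mono mult_right_mono) auto
    finally show ?thesis .
  qed
  have lip: "f (u + y) - f (u + x) \<le> M * p * (y - x)" if "s \<le> x" "x < y" "y \<le> r" for x y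
  proof -
    have "M * p * (y powr (p - 1) * (y - x)) \<le> M * p * (1 * (y - x))"
      using that s p Mp powr_mono2[of "p - 1" y 1] by (intro mult_left_mono mult_right_mono) auto
    then show ?thesis using up[OF that] by simp
  qed
  have incr: "0 \<le> f (u + y) - f (u + x)" if "s \<le> x" "x < y" "y \<le> r" for x y
  proof -
    have "0 \<le> m * (y powr p - x powr p)" using m pw_less[of x y] that by simp
    then show ?thesis using f_diff[OF that] by linarith
  qed
  define C where "C = 2 * \<Lambda> * p + M * p / m + M * p"
  have C: "2 * \<Lambda> * p \<le> C" "M * p / m \<le> C" "M * p \<le> C" "0 \<le> C"
    using \<Lambda> p Mp m unfolding C_def by auto
  have "tame f (u + s) (u + r) C"
  proof (rule tameI)
    fix a b c d assume *: "u + s < a" "a < b" "b < c" "c < d" "d < u + r"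
    have "cross_ratio (f a) (f b) (f c) (f d)
        \<le> exp (2 * \<Lambda> * p * (d - a)) * cross_ratio (a - u) (b - u) (c - u) (d - u)"
      using cr[of "a - u" "b - u" "c - u" "d - u"] * by simp
    also have "cross_ratio (a - u) (b - u) (c - u) (d - u) = cross_ratio a b c d"
      using cross_ratio_shift[of a "- u" b c d] by simp
    also have "exp (2 * \<Lambda> * p * (d - a)) * cross_ratio a b c d \<le> exp (C * (d - a)) * cross_ratio a b c d"
      using * C(1) less_imp_le[OF cross_ratio_pos[of a b c d]]
      by (intro mult_right_mono) (auto intro!: mult_right_mono)
    finally show "cross_ratio (f a) (f b) (f c) (f d) \<le> exp (C * (d - a)) * cross_ratio a b c d" .
  next
    fix a b c assume *: "u + s \<le> a" "a < b" "b < c" "c \<le> u + r"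
    have nn: "0 \<le> (f c - f a) * w" if "0 \<le> w" for w
      using incr[of "a - u" "c - u"] * that by simp
    show "(f b - f a) * (c - a) \<le> C * ((f c - f a) * (b - a))"
      using ratio[of "a - u" "c - u" "a - u" "b - u"] * mult_right_mono[OF C(2) nn[of "b - a"]] by simp
    show "(f c - f b) * (c - a) \<le> C * ((f c - f a) * (c - b))"
      using ratio[of "a - u" "c - u" "b - u" "c - u"] * mult_right_mono[OF C(2) nn[of "c - b"]] by simp
  next
    fix a b assume *: "u + s \<le> a" "a < b" "b \<le> u + r"
    then have "f b - f a \<le> M * p * (b - a)" using lip[of "a - u" "b - u"] by simp
    also have "\<dots> \<le> C * (b - a)" using * C(3) by (intro mult_right_mono) auto
    finally show "f b - f a \<le> C * (b - a)" .
  qed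
  then show thesis by (rule that[OF C(4)])
qed

section \<open>Lifts with a flat interval\<close>

text \<open>The conditions say that each gap avoids the flat interval or contains all of it, and
  that \<open>[b, c]\<close> lies strictly between two flat intervals. Fibre endpoints produce such
  quadruples, because a flat interval lies in a single fibre.\<close>

definition bounded_distortion :: "(real \<Rightarrow> real) \<Rightarrow> real \<Rightarrow> real \<Rightarrow> real \<Rightarrow> bool" where
  "bounded_distortion f \<alpha> \<beta> C \<longleftrightarrow>
     (\<forall>a b c d. a < b \<and> b < c \<and> c < d \<and> d < a + 1 \<and> \<beta> < b \<and> c < \<alpha> + 1 \<and>
        (a \<le> \<alpha> \<or> \<beta> < a) \<and> (d < \<alpha> + 1 \<or> \<beta> + 1 \<le> d) \<longrightarrow>
        cross_ratio (f a) (f b) (f c) (f d) \<le> exp (C * (d - a)) * cross_ratio a b c d)"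

locale flat_interval_lift = degree_one_lift +
  fixes \<alpha> \<beta> :: real
  assumes \<alpha>_less: "\<alpha> < \<beta>" "\<beta> < \<alpha> + 1"
    and flat: "\<alpha> \<le> x \<Longrightarrow> x \<le> \<beta> \<Longrightarrow> f x = f \<alpha>"
    and strict: "\<beta> \<le> x \<Longrightarrow> x < y \<Longrightarrow> y \<le> \<alpha> + 1 \<Longrightarrow> f x < f y"
begin

text \<open>
  Quadruples longer than some \<open>\<epsilon>\<close>, in particular those reaching across a flat interval, only
  satisfy a bound with a constant factor, which is absorbed into \<open>exp (C * (d - a))\<close>.
\<close>

lemma bounded_distortionI:
  assumes e: "0 < e" "4 * e \<le> \<alpha> + 1 - \<beta>"
    and tame: "tame f \<beta> (\<beta> + 2 * e) C" "tame f (\<beta> + e) (\<alpha> + 1 - e) C"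
      "tame f (\<alpha> + 1 - 2 * e) (\<alpha> + 1) C"
    and "0 \<le> C"
  obtains C where "0 \<le> C" "bounded_distortion f \<alpha> \<beta> C"
proof -
  have le: "f x \<le> f y" if "x \<le> y" for x y using monoD[OF mono_f that] .
  \<comment> \<open>Consecutive pieces overlap in length \<open>e\<close>, so an interval of length
    at most \<open>e\<close> lies in one of them.\<close>
  define region where "region s t \<longleftrightarrow> (s = \<beta> \<and> t = \<beta> + 2 * e) \<or> (s = \<beta> + e \<and> t = \<alpha> + 1 - e)
    \<or> (s = \<alpha> + 1 - 2 * e \<and> t = \<alpha> + 1)" for s t
  have C: "tame f s t C" if "region s t" for s t
    using that tame unfolding region_def by blast
  have cover: "\<exists>s t. region s t \<and> s \<le> a \<and> c \<le> t" if "\<beta> \<le> a" "c \<le> \<alpha> + 1" "c - a \<le> e" for a c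
    using that e unfolding region_def by (cases "a \<le> \<beta> + e"; cases "c \<le> \<alpha> + 1 - e") force+
  have cover': "\<exists>s t. region s t \<and> s < a \<and> c < t" if "\<beta> < a" "c < \<alpha> + 1" "c - a < e" for a c
    using that e unfolding region_def by (cases "a \<le> \<beta> + e"; cases "c < \<alpha> + 1 - e") force+
  define \<Lambda> where "\<Lambda> = max C (1 / e)"
  have \<Lambda>: "C \<le> \<Lambda>" "1 / e \<le> \<Lambda>" "0 \<le> \<Lambda>" using \<open>0 \<le> C\<close> unfolding \<Lambda>_def by auto
  have lip: "f b - f a \<le> \<Lambda> * (b - a)" if *: "\<beta> \<le> a" "a < b" "b \<le> \<alpha> + 1" for a b
  proof (cases "b - a \<le> e")
    case True
    then obtain s t where "region s t" "s \<le> a" "b \<le> t" using cover * by blast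
    then have "f b - f a \<le> C * (b - a)" using tameD(4)[OF C] * by fastforce
    also have "\<dots> \<le> \<Lambda> * (b - a)" using \<Lambda> * by (intro mult_right_mono) auto
    finally show ?thesis .
  next
    case False
    have "f b \<le> f \<alpha> + 1" "f \<alpha> \<le> f a" using le[of b "\<alpha> + 1"] le[of \<alpha> a] * \<alpha>_less shift1 by auto
    then have "f b - f a \<le> 1" by simp
    also have "\<dots> \<le> (1 / e) * (b - a)" using False e by (simp add: field_simps)
    also have "\<dots> \<le> \<Lambda> * (b - a)" using \<Lambda> * by (intro mult_right_mono) auto
    finally show ?thesis .
  qed
  \<comment> \<open>Compactness and strict monotonicity give a positive least increment over steps
    of length \<open>e\<close>, which bounds the denominators on long intervals from below.\<close>
  obtain m1 where m1: "0 < m1" "\<And>x. \<beta> \<le> x \<Longrightarrow> x \<le> \<alpha> + 1 - e \<Longrightarrow> m1 \<le> f (x + e) - f x"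
  proof -
    have "continuous_on {\<beta>..\<alpha> + 1 - e} (\<lambda>x. f (x + e) - f x)"
      by (intro continuous_intros continuous_on_compose2[OF cont]) auto
    moreover have "{\<beta>..\<alpha> + 1 - e} \<noteq> {}" using e by auto
    ultimately obtain x0 where x0: "x0 \<in> {\<beta>..\<alpha> + 1 - e}"
      "\<forall>y\<in>{\<beta>..\<alpha> + 1 - e}. f (x0 + e) - f x0 \<le> f (y + e) - f y"
      using continuous_attains_inf[of "{\<beta>..\<alpha> + 1 - e}"] by blast
    then have "0 < f (x0 + e) - f x0" using strict[of x0 "x0 + e"] e by auto
    then show thesis using that[of "f (x0 + e) - f x0"] x0 by auto
  qed
  have big: "m1 \<le> f c - f a" if "\<beta> \<le> a" "c \<le> \<alpha> + 1" "e < c - a" for a c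
    using m1(2)[of a] le[of "a + e" c] that by force
  define K where "K = max (max C (\<Lambda> / m1)) (max 1 (1 / (\<beta> - \<alpha>)))"
  have K: "C \<le> K" "\<Lambda> / m1 \<le> K" "1 \<le> K" "1 / (\<beta> - \<alpha>) \<le> K" unfolding K_def by auto
  have ratio: "(f y - f x) * (c - a) \<le> K * ((f c - f a) * (y - x))"
    if *: "\<beta> \<le> a" "a < c" "c \<le> \<alpha> + 1" "x < y" "(x = a \<and> y < c) \<or> (a < x \<and> y = c)" for a c x y
  proof (cases "c - a \<le> e")
    case True
    then obtain s t where st: "region s t" "s \<le> a" "c \<le> t" using cover * by blast
    then have "(f y - f x) * (c - a) \<le> C * ((f c - f a) * (y - x))"
      using tameD(2,3)[OF C[OF st(1)]] * by fastforce
    also have "\<dots> \<le> K * ((f c - f a) * (y - x))"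
      using K * le[of a c] by (intro mult_right_mono) auto
    finally show ?thesis .
  next
    case False
    have yx: "f y - f x \<le> \<Lambda> * (y - x)" using lip[of x y] * by auto
    have "f x \<le> f y" using le[of x y] * by simp
    then have "(f y - f x) * (c - a) \<le> (f y - f x) * 1"
      using * \<alpha>_less by (intro mult_left_mono) auto
    also have "\<dots> \<le> \<Lambda> * (y - x)" using yx by simp
    also have "\<dots> = (\<Lambda> / m1) * (m1 * (y - x))" using m1 by simp
    also have "\<dots> \<le> K * ((f c - f a) * (y - x))"
      using big[of a c] False * m1 K \<Lambda> by (intro mult_mono mult_right_mono) auto
    finally show ?thesis .
  qed
  have left: "(f b - f a) / (f c - f a) \<le> K * ((b - a) / (c - a))"
    if *: "a < b" "b < c" "\<beta> < b" "c < \<alpha> + 1" "a \<le> \<alpha> \<or> \<beta> < a" "c < a + 1" for a b c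
  proof -
    have s: "f a \<le> f b" "f b < f c" using strict[of b c] le[of a b] * by auto
    show ?thesis
    proof (cases "\<beta> < a")
      case True
      then have "(f b - f a) * (c - a) \<le> K * ((f c - f a) * (b - a))" using ratio[of a c a b] * by auto
      then show ?thesis using s * by (simp add: field_simps)
    next
      case False
      \<comment> \<open>Here the gap contains the flat interval: the image ratio is at most 1, while
        the original ratio is at least \<beta> - \<alpha> because \<open>c - a < 1\<close>.\<close>
      have "(f b - f a) / (f c - f a) \<le> 1" using s by simp
      also have "1 \<le> K * (\<beta> - \<alpha>)" using K(4) \<alpha>_less by (simp add: field_simps)
      also have "\<dots> \<le> K * ((b - a) / (c - a))"
      proof (rule mult_left_mono)
        have "(\<beta> - \<alpha>) * (c - a) \<le> (\<beta> - \<alpha>) * 1" using * \<alpha>_less by (intro mult_left_mono) auto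
        also have "\<dots> \<le> b - a" using False * by auto
        finally show "\<beta> - \<alpha> \<le> (b - a) / (c - a)" using * by (simp add: field_simps)
      qed (use K in simp)
      finally show ?thesis .
    qed
  qed
  have right: "(f d - f c) / (f d - f b) \<le> K * ((d - c) / (d - b))"
    if *: "b < c" "c < d" "\<beta> < b" "c < \<alpha> + 1" "d < \<alpha> + 1 \<or> \<beta> + 1 \<le> d" "d < b + 1" for b c d
  proof -
    have s: "f b < f c" "f c \<le> f d" using strict[of b c] le[of c d] * by auto
    show ?thesis
    proof (cases "d < \<alpha> + 1")
      case True
      then have "(f d - f c) * (d - b) \<le> K * ((f d - f b) * (d - c))" using ratio[of b d c d] * by auto
      then show ?thesis using s * by (simp add: field_simps)
    next
      case False
      have "(f d - f c) / (f d - f b) \<le> 1" using s by simp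
      also have "1 \<le> K * (\<beta> - \<alpha>)" using K(4) \<alpha>_less by (simp add: field_simps)
      also have "\<dots> \<le> K * ((d - c) / (d - b))"
      proof (rule mult_left_mono)
        have "(\<beta> - \<alpha>) * (d - b) \<le> (\<beta> - \<alpha>) * 1" using * \<alpha>_less by (intro mult_left_mono) auto
        also have "\<dots> \<le> d - c" using False * by auto
        finally show "\<beta> - \<alpha> \<le> (d - c) / (d - b)" using * by (simp add: field_simps)
      qed (use K in simp)
      finally show ?thesis .
    qed
  qed
  \<comment> \<open>A quadruple shorter than \<epsilon> crosses no flat interval and fits into one
    piece. For all others the term \<open>ln (K * K) / \<epsilon>\<close> in \<open>C'\<close> makes
    the exponential at least \<open>K * K\<close>.\<close>
  define \<epsilon> where "\<epsilon> = min e (\<beta> - \<alpha>)"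
  have \<epsilon>: "0 < \<epsilon>" "\<epsilon> \<le> e" "\<epsilon> \<le> \<beta> - \<alpha>" using e \<alpha>_less unfolding \<epsilon>_def by auto
  define C' where "C' = max C (ln (K * K) / \<epsilon>)"
  have C': "C \<le> C'" "ln (K * K) / \<epsilon> \<le> C'" "0 \<le> C'" using \<open>0 \<le> C\<close> unfolding C'_def by auto
  have "bounded_distortion f \<alpha> \<beta> C'"
    unfolding bounded_distortion_def
  proof (intro allI impI, elim conjE)
    fix a b c d
    assume *: "a < b" "b < c" "c < d" "d < a + 1" "\<beta> < b" "c < \<alpha> + 1"
      "a \<le> \<alpha> \<or> \<beta> < a" "d < \<alpha> + 1 \<or> \<beta> + 1 \<le> d"
    have cr0: "0 \<le> cross_ratio a b c d" using * by (intro less_imp_le cross_ratio_pos)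
    show "cross_ratio (f a) (f b) (f c) (f d) \<le> exp (C' * (d - a)) * cross_ratio a b c d"
    proof (cases "d - a < \<epsilon>")
      case True
      then have "\<beta> < a" "d < \<alpha> + 1" using * \<epsilon> by auto
      then obtain s t where "region s t" "s < a" "d < t" using cover'[of a d] True \<epsilon> by auto
      then have "cross_ratio (f a) (f b) (f c) (f d) \<le> exp (C * (d - a)) * cross_ratio a b c d"
        using tameD(1)[OF C] * by fastforce
      also have "\<dots> \<le> exp (C' * (d - a)) * cross_ratio a b c d"
        using C'(1) * cr0 by (intro mult_right_mono) (auto intro!: mult_right_mono)
      finally show ?thesis .
    next
      case False
      have nn: "0 \<le> (f d - f c) / (f d - f b)" 
        using le[of c d] le[of b d] * by simp
      have "cross_ratio (f a) (f b) (f c) (f d)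
          = (f b - f a) / (f c - f a) * ((f d - f c) / (f d - f b))"
        unfolding cross_ratio_def by simp
      also have "\<dots> \<le> (K * ((b - a) / (c - a))) * (K * ((d - c) / (d - b)))"
        using left[of a b c] right[of b c d] * nn K by (intro mult_mono) auto
      also have "\<dots> = (K * K) * cross_ratio a b c d" unfolding cross_ratio_def by simp
      also have "\<dots> \<le> exp (C' * (d - a)) * cross_ratio a b c d"
      proof (rule mult_right_mono[OF _ cr0])
        have KK: "1 \<le> K * K" using K(3) mult_mono[of 1 K 1 K] by simp
        have "ln (K * K) = (ln (K * K) / \<epsilon>) * \<epsilon>" using \<epsilon> by simp
        also have "\<dots> \<le> C' * (d - a)"
          using C' \<epsilon> False KK by (intro mult_mono) auto
        finally have "exp (ln (K * K)) \<le> exp (C' * (d - a))" by simp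
        then show "K * K \<le> exp (C' * (d - a))" using KK by simp
      qed
      finally show ?thesis .
    qed
  qed
  then show thesis using that C'(3) by blast
qed

end

section \<open>Fibres of the semiconjugacy\<close>

locale flat_rotation = flat_interval_lift f \<alpha> \<beta> + rotation_semiconjugacy f H \<rho>
  for f \<alpha> \<beta> H \<rho> +
  assumes H_\<alpha>: "H \<alpha> = 0"
    and distortion: "\<exists>C\<ge>0. bounded_distortion f \<alpha> \<beta> C"
begin

section \<open>Position of fibres relative to the flat intervals\<close>

lemma H_flat: "\<alpha> \<le> x \<Longrightarrow> x \<le> \<beta> \<Longrightarrow> H x = 0"
  using H_f[of x] H_f[of \<alpha>] flat[of x] H_\<alpha> by simp

lemma flat_in_fibre: "lo (of_int k) \<le> \<alpha> + of_int k" "\<beta> + of_int k \<le> hi (of_int k)"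
proof -
  have "H (\<alpha> + of_int k) = of_int k" "H (\<beta> + of_int k) = of_int k"
    using HL.shift_int[of \<alpha> k] HL.shift_int[of \<beta> k] H_flat[of \<alpha>] H_flat[of \<beta>] \<alpha>_less by auto
  then show "lo (of_int k) \<le> \<alpha> + of_int k" "\<beta> + of_int k \<le> hi (of_int k)"
    using fibre_iff by auto
qed

lemma strict_shift:
  assumes "\<beta> + of_int k \<le> x" "x < y" "y \<le> \<alpha> + 1 + of_int k"
  shows "f x < f y"
  using strict[of "x + of_int (- k)" "y + of_int (- k)"] assms
  unfolding shift_int by simp

lemma fibre_between:
  assumes "s \<notin> \<int>"
  shows "\<beta> + of_int \<lfloor>s\<rfloor> < lo s" "hi s < \<alpha> + 1 + of_int \<lfloor>s\<rfloor>"
proof -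
  have s: "of_int \<lfloor>s\<rfloor> < s" "s < of_int (\<lfloor>s\<rfloor> + 1)"
    using assms of_int_floor_le[of s] floor_correct[of s] by (auto simp: less_le)
  show "\<beta> + of_int \<lfloor>s\<rfloor> < lo s"
    using hi_less_lo[OF s(1)] flat_in_fibre(2)[of "\<lfloor>s\<rfloor>"] by simp
  show "hi s < \<alpha> + 1 + of_int \<lfloor>s\<rfloor>"
    using hi_less_lo[OF s(2)] flat_in_fibre(1)[of "\<lfloor>s\<rfloor> + 1"] by simp
qed

lemma strict_on_fibre:
  assumes "s \<notin> \<int>" "H x = s" "H y = s" "x < y"
  shows "f x < f y"
  using fibre_between[OF assms(1)] fibre_iff[of x s] fibre_iff[of y s] assms
  by (intro strict_shift[of "\<lfloor>s\<rfloor>"]) auto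

text \<open>Since \<open>f\<close> maps fibre endpoints to fibre endpoints, it carries the quadruple
  over \<open>s\<close> to the one over \<open>s + \<rho>\<close>. The outer points are endpoints of
  fibres, hence never inside a flat interval, and \<open>x + y < 1\<close> keeps the quadruple
  shorter than a period.\<close>

lemma cross_ratio_step:
  assumes C: "bounded_distortion f \<alpha> \<beta> C"
    and s: "s \<notin> \<int>" "lo s < hi s" and xy: "0 < x" "0 < y" "x + y < 1"
  shows "cross_ratio (lo (s + \<rho> - x)) (lo (s + \<rho>)) (hi (s + \<rho>)) (hi (s + \<rho> + y))
    \<le> exp (C * (hi (s + y) - lo (s - x))) * cross_ratio (lo (s - x)) (lo s) (hi s) (hi (s + y))"
proof -
  define k where "k = \<lfloor>s\<rfloor>"
  define sh where "sh z = z + of_int (- k)" for z :: real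
  have "cross_ratio (f (sh (lo (s - x)))) (f (sh (lo s))) (f (sh (hi s))) (f (sh (hi (s + y))))
    \<le> exp (C * (sh (hi (s + y)) - sh (lo (s - x))))
        * cross_ratio (sh (lo (s - x))) (sh (lo s)) (sh (hi s)) (sh (hi (s + y)))"
  proof (rule C[unfolded bounded_distortion_def, rule_format], intro conjI)
    show "sh (lo (s - x)) < sh (lo s)" using hi_less_lo[of "s - x" s] lo_le_hi[of "s - x"] xy
      unfolding sh_def by simp
    show "sh (hi s) < sh (hi (s + y))" using hi_less_lo[of s "s + y"] lo_le_hi[of "s + y"] xy
      unfolding sh_def by simp
    have "hi (s + y) < lo (s - x) + 1"
      using hi_less_lo[of "s + y" "s - x + 1"] lo_shift[of "s - x" 1] xy by simp
    then show "sh (hi (s + y)) < sh (lo (s - x)) + 1" unfolding sh_def by simp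
    show "sh (lo (s - x)) \<le> \<alpha> \<or> \<beta> < sh (lo (s - x))"
    proof (cases "s - x \<le> of_int k")
      case True
      then show ?thesis using lo_mono[of "s - x" "of_int k"] flat_in_fibre(1)[of k] unfolding sh_def by simp
    next
      case False
      then show ?thesis using hi_less_lo[of "of_int k" "s - x"] flat_in_fibre(2)[of k] unfolding sh_def by simp
    qed
    show "sh (hi (s + y)) < \<alpha> + 1 \<or> \<beta> + 1 \<le> sh (hi (s + y))"
    proof (cases "s + y < of_int (k + 1)")
      case True
      then show ?thesis
        using hi_less_lo[of "s + y" "of_int (k + 1)"] flat_in_fibre(1)[of "k + 1"] unfolding sh_def by simp
    next
      case False
      then have "hi (of_int (k + 1)) \<le> hi (s + y)"
        using hi_less_lo[of "of_int (k + 1)" "s + y"] lo_le_hi[of "s + y"]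
        by (cases "s + y = of_int (k + 1)") auto
      then show ?thesis using flat_in_fibre(2)[of "k + 1"] unfolding sh_def by simp
    qed
  qed (use fibre_between[OF s(1)] s(2) in \<open>auto simp: sh_def k_def\<close>)
  moreover have "f (sh z) = f z + of_int (- k)" for z unfolding sh_def by (rule shift_int)
  ultimately show ?thesis
    unfolding sh_def by (simp only: cross_ratio_shift f_lo f_hi) (simp add: algebra_simps)
qed

text \<open>Since \<open>lo t\<close> is the least point of its fibre, \<open>H\<close> is strictly
  below \<open>t\<close> at \<open>lo t - e\<close>; the difference serves as \<delta>. This makes
  the left gap at time 0 short.\<close>

lemma lo_left_continuous:
  assumes "0 < e"
  obtains \<delta> where "0 < \<delta>" "\<And>x. x < \<delta> \<Longrightarrow> lo t - e < lo (t - x)"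
proof (rule that)
  have "H (lo t - e) \<le> t" using monoD[OF H_mono, of "lo t - e" "lo t"] H_lo assms by simp
  moreover have "H (lo t - e) \<noteq> t" using fibre_iff assms by fastforce
  ultimately show "0 < t - H (lo t - e)" by simp
  show "lo t - e < lo (t - x)" if "x < t - H (lo t - e)" for x
    using H_less_imp[of "lo t - e" "lo (t - x)"] H_lo[of "t - x"] that by simp
qed

text \<open>
  If \<open>J\<close> is a nondegenerate fibre and \<open>N\<close> is the time at which its image is shortest among the
  first \<open>Q\<close> ones, the neighbours of that image are longer, so its cross-ratio with respect to the
  gaps reaching to the far ends of the neighbours is at least \<open>1/4\<close>.  At time 0 the same cross-ratio
  is small, because the gaps pulled back to \<open>J\<close> shrink as \<open>Q\<close> grows.
\<close>

theorem fibre_trivial: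
  assumes t: "\<And>i::nat. t + real i * \<rho> \<notin> \<int>"
  shows "lo t = hi t"
proof (rule ccontr)
  assume "lo t \<noteq> hi t"
  then have J: "lo t < hi t" using lo_le_hi[of t] by simp
  define tt where "tt i = t + real i * \<rho>" for i :: nat
  have tt_Suc: "tt (Suc i) = tt i + \<rho>" for i unfolding tt_def by (simp add: algebra_simps)
  have nondeg: "lo (tt i) < hi (tt i)" for i
  proof (induction i)
    case (Suc i)
    show ?case using strict_on_fibre[OF t H_lo H_hi, of i] Suc unfolding tt_Suc
      by (simp add: f_lo f_hi tt_def)
  qed (use J in \<open>simp add: tt_def\<close>)
  define len where "len i = hi (tt i) - lo (tt i)" for i
  obtain C where C: "0 \<le> C" "bounded_distortion f \<alpha> \<beta> C" using distortion by blast
  define M where "M = hi t - lo t"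
  \<comment> \<open>Chosen so that \<open>exp (5 * C) * (e / M)\<close> equals 1/8, which is below
    1/4; the 5 is the bound on the total length.\<close>
  define e where "e = M * exp (- (5 * C)) / 8"
  have "0 < M" "0 < e" using J unfolding M_def e_def by simp_all
  obtain \<delta> where \<delta>: "0 < \<delta>" "\<And>x. x < \<delta> \<Longrightarrow> lo t - e < lo (t - x)"
    using lo_left_continuous[OF \<open>0 < e\<close>] by blast
  \<comment> \<open>The gaps will reach at most \<open>2 * D\<close> to each side in the rotation
    coordinate: \<open>D < 1/5\<close> then gives \<open>x + y < 1\<close>, and
    \<open>D < \<delta> / 3\<close> gives \<open>x < \<delta>\<close>.\<close>
  have "0 < min (1 / 5) (\<delta> / 3)" using \<delta> by simp
  then obtain Q :: nat and D :: real where D: "0 < D" "D < min (1 / 5) (\<delta> / 3)" "0 < Q"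
    and sep: "\<And>i j m. i < Q \<Longrightarrow> j < Q \<Longrightarrow> i \<noteq> j \<Longrightarrow> D \<le> \<bar>(real i - real j) * \<rho> - of_int m\<bar>"
    and right: "\<And>N. N < Q \<Longrightarrow> \<exists>l<Q. \<exists>m. 0 < (real l - real N) * \<rho> + of_int m
                              \<and> (real l - real N) * \<rho> + of_int m \<le> 2 * D"
    and left: "\<And>N. N < Q \<Longrightarrow> \<exists>l<Q. \<exists>m. (real l - real N) * \<rho> + of_int m < 0
                              \<and> - 2 * D \<le> (real l - real N) * \<rho> + of_int m"
    by (rule closest_return[OF irr]) (rule that)
  obtain N where "is_arg_min len (\<lambda>i. i \<in> {..<Q}) N"
    using ex_is_arg_min_if_finite[of "{..<Q}" len] D(3) by auto
  then have N: "N < Q" "\<And>i. i < Q \<Longrightarrow> len N \<le> len i"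
    by (auto simp: is_arg_min_linorder)
  obtain r m where r: "r < Q" "0 < (real r - real N) * \<rho> + of_int m"
      "(real r - real N) * \<rho> + of_int m \<le> 2 * D"
    using right[OF N(1)] by blast
  obtain l m' where l: "l < Q" "(real l - real N) * \<rho> + of_int m' < 0"
      "- 2 * D \<le> (real l - real N) * \<rho> + of_int m'"
    using left[OF N(1)] by blast
  define y where "y = (real r - real N) * \<rho> + of_int m"
  define x where "x = - ((real l - real N) * \<rho> + of_int m')"
  have xy: "0 < x" "0 < y" "x \<le> 2 * D" "y \<le> 2 * D" "x + y < 1"
    using r l D unfolding x_def y_def by auto
  define cr where "cr i = cross_ratio (lo (tt i - x)) (lo (tt i)) (hi (tt i)) (hi (tt i + y))" for i
  define w where "w i = hi (tt i + y) - lo (tt i - x)" for i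
  have w_pos: "0 \<le> w i" for i
    using lo_mono[of "tt i - x" "tt i + y"] lo_le_hi[of "tt i + y"] xy unfolding w_def by simp
  have cr_le: "cr n \<le> exp (C * (\<Sum>i<n. w i)) * cr 0" for n
  proof (induction n)
    case (Suc n)
    have "cr (Suc n) \<le> exp (C * w n) * cr n"
      using cross_ratio_step[OF C(2) t nondeg[unfolded tt_def] xy(1,2,5), of n]
      unfolding cr_def w_def tt_Suc unfolding tt_def .
    also have "\<dots> \<le> exp (C * w n) * (exp (C * (\<Sum>i<n. w i)) * cr 0)"
      using Suc by (intro mult_left_mono) auto
    also have "\<dots> = exp (C * (\<Sum>i<Suc n. w i)) * cr 0"
      by (simp add: exp_add[symmetric] algebra_simps)
    finally show ?case .
  qed simp
  have cr0: "0 < cr 0"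
    unfolding cr_def using nondeg[of 0] hi_less_lo[of "tt 0 - x" "tt 0"] lo_le_hi[of "tt 0 - x"]
      hi_less_lo[of "tt 0" "tt 0 + y"] lo_le_hi[of "tt 0 + y"] xy
    by (intro cross_ratio_pos) auto
  have "(\<Sum>i<N. w i) \<le> (\<Sum>i<Q. w i)"
    using N(1) w_pos by (intro sum_mono2) auto
  also have "\<dots> \<le> 5"
    unfolding w_def
  proof (rule separated_total_length[OF D(3) D(1)])
    fix i j k assume "i < Q" "j < Q" "i \<noteq> j"
    then show "D \<le> \<bar>tt i - tt j - of_int k\<bar>" using sep[of i j k] unfolding tt_def by (simp add: algebra_simps)
  qed (use xy D in auto)
  finally have "C * (\<Sum>i<N. w i) \<le> 5 * C" using mult_left_mono[OF _ C(1), of "\<Sum>i<N. w i" 5] by simp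
  then have "exp (C * (\<Sum>i<N. w i)) * cr 0 \<le> exp (5 * C) * cr 0"
    using cr0 by (intro mult_right_mono) auto
  with cr_le[of N] have up: "cr N \<le> exp (5 * C) * cr 0" by simp
  have low: "1 / 4 \<le> cr N"
  proof -
    define A B where "A = lo (tt N) - lo (tt N - x)" and "B = hi (tt N + y) - hi (tt N)"
    \<comment> \<open>The left gap begins at the far end of a translate of the fibre over
      \<open>tt l\<close>; it contains that whole fibre and is at least as long as
      \<open>len l\<close>, hence as \<open>len N\<close>.\<close>
    have "tt N - x = tt l + of_int m'" unfolding x_def tt_def by (simp add: algebra_simps)
    then have "len l = hi (tt N - x) - lo (tt N - x)" unfolding len_def by (simp add: lo_shift hi_shift)
    then have A: "len N \<le> A" using N(2)[OF l(1)] hi_less_lo[of "tt N - x" "tt N"] xy unfolding A_def by simp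
    have "tt N + y = tt r + of_int m" unfolding y_def tt_def by (simp add: algebra_simps)
    then have "len r = hi (tt N + y) - lo (tt N + y)" unfolding len_def by (simp add: lo_shift hi_shift)
    then have B: "len N \<le> B" using N(2)[OF r(1)] hi_less_lo[of "tt N" "tt N + y"] xy unfolding B_def by simp
    have pos: "0 < len N" unfolding len_def using nondeg[of N] by simp
    have "1 / 2 * (1 / 2) \<le> A / (A + len N) * (B / (len N + B))"
      using A B pos by (intro mult_mono) (auto simp: field_simps)
    also have "\<dots> = cr N" unfolding cr_def cross_ratio_def A_def B_def len_def by (simp add: algebra_simps)
    finally show ?thesis by simp
  qed
  have "cr 0 \<le> e / M"
  proof -
    define A B where "A = lo t - lo (t - x)" and "B = hi (t + y) - hi t"
    have AB: "0 < A" "0 < B" "A < e"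
      using \<delta>(2)[of x] xy D hi_less_lo[of "t - x" t] lo_le_hi[of "t - x"]
        hi_less_lo[of t "t + y"] lo_le_hi[of "t + y"] unfolding A_def B_def by auto
    have "cr 0 = A / (A + M) * (B / (M + B))"
      unfolding cr_def cross_ratio_def A_def B_def M_def tt_def by (simp add: algebra_simps)
    \<comment> \<open>Shortness of the left gap is enough; the factor of the right gap is bounded by
      1.\<close>
    also have "\<dots> \<le> (e / M) * 1"
      using AB \<open>0 < M\<close> by (intro mult_mono frac_le) auto
    finally show ?thesis by simp
  qed
  then have "exp (5 * C) * cr 0 \<le> exp (5 * C) * (e / M)" by (intro mult_left_mono) auto
  also have "\<dots> = 1 / 8" using \<open>0 < M\<close> unfolding e_def by (simp add: exp_minus field_simps)
  finally show False using up low by simp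
qed

text \<open>The fibre over \<rho> is a point, as its rotation orbit never meets an integer. Hence
  \<open>f\<close> identifies both ends of the fibre over 0, and strict monotonicity beside the flat
  interval leaves no room beyond \<alpha> and \<beta>.\<close>

lemma flat_fibre: "lo 0 = \<alpha>" "hi 0 = \<beta>"
proof -
  have "\<rho> + real i * \<rho> \<notin> \<int>" for i :: nat
  proof
    assume "\<rho> + real i * \<rho> \<in> \<int>"
    then obtain m where "\<rho> + real i * \<rho> = of_int m" by (auto elim: Ints_cases)
    then show False
      using irrational_multiple_ne[OF irr, of "int i + 1" m] by (simp add: algebra_simps)
  qed
  then have eq: "f (lo 0) = f (hi 0)" using fibre_trivial[of \<rho>] f_lo[of 0] f_hi[of 0] by simp
  have le: "lo 0 \<le> \<alpha>" "\<beta> \<le> hi 0" using flat_in_fibre[of 0] by simp_all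
  have fm: "f (lo 0) \<le> f \<alpha>" "f \<beta> \<le> f (hi 0)" "f \<beta> = f \<alpha>"
    using monoD[OF mono_f] le flat[of \<beta>] \<alpha>_less by auto
  have "\<beta> - 1 \<le> lo 0" using hi_less_lo[of "-1" 0] flat_in_fibre(2)[of "-1"] by simp
  then show "lo 0 = \<alpha>" using strict_shift[of "-1" "lo 0" \<alpha>] le fm eq by force
  have "hi 0 \<le> \<alpha> + 1" using hi_less_lo[of 0 1] flat_in_fibre(1)[of 1] by simp
  then show "hi 0 = \<beta>" using strict[of \<beta> "hi 0"] le fm eq by force
qed

lemma fibre_int_iff: "H x = of_int m \<longleftrightarrow> \<alpha> + of_int m \<le> x \<and> x \<le> \<beta> + of_int m"
  using fibre_iff[of x "of_int m"] lo_shift[of 0 m] hi_shift[of 0 m] flat_fibre by simp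

text \<open>By irrationality the rotation orbit meets the integers at most once, so each step before
  time \<open>i\<close> acts on a fibre without flat interval.\<close>

lemma funpow_strict_on_fibre:
  assumes "s + real i * \<rho> = of_int m" "H x = s" "H y = s" "x < y"
  shows "(f ^^ i) x < (f ^^ i) y"
proof -
  have "(f ^^ j) x < (f ^^ j) y" if "j \<le> i" for j
    using that
  proof (induction j)
    case (Suc j)
    have "s + real j * \<rho> \<notin> \<int>"
    proof
      assume "s + real j * \<rho> \<in> \<int>"
      then obtain m' where "s + real j * \<rho> = of_int m'" by (auto elim: Ints_cases)
      with assms(1) have "of_int (int i - int j) * \<rho> = of_int (m - m')" by (simp add: algebra_simps)
      then show False using irrational_multiple_ne[OF irr, of "int i - int j" "m - m'"] Suc.prems by simp
    qed
    then show ?case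
      using strict_on_fibre[of "s + real j * \<rho>" "(f ^^ j) x" "(f ^^ j) y"] H_funpow assms(2,3) Suc by simp
  qed (use assms in simp)
  then show ?thesis by simp
qed

lemma fibre_point:
  assumes "H x = H y" "\<And>i m. H x + real i * \<rho> \<noteq> of_int m"
  shows "x = y"
proof -
  have "lo (H x) = hi (H x)"
    using assms(2) by (intro fibre_trivial) (auto elim!: Ints_cases)
  then show ?thesis using fibre_iff[of x "H x"] fibre_iff[of y "H x"] assms(1) by simp
qed

lemma funpow_fibre_surj: "H y = t + real i * \<rho> \<Longrightarrow> \<exists>x. H x = t \<and> (f ^^ i) x = y"
proof (induction i arbitrary: y)
  case (Suc i)
  then obtain z where "H z = t + real i * \<rho>" "f z = y"
    using fibre_image[of y "t + real i * \<rho>"] by (auto simp: algebra_simps)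
  then show ?case using Suc.IH[of z] by auto
qed auto

text \<open>If \<open>x\<close> and \<open>y\<close> share a fibre, it is nondegenerate and is
  carried into a flat interval. Otherwise a positive rotation step shorter than
  \<open>H y - H x\<close> returns \<open>x\<close> to the interval.\<close>

lemma no_wandering_interval:
  assumes "x < y"
  obtains (meets_flat) n m w where "x \<le> w" "w \<le> y" "\<alpha> + of_int m < (f ^^ n) w" "(f ^^ n) w < \<beta> + of_int m"
  | (returns) n m where "0 < n" "x \<le> (f ^^ n) x + of_int m" "(f ^^ n) x + of_int m \<le> y"
proof (cases "H x = H y")
  case True
  have "\<exists>i m. H x + real i * \<rho> = of_int m"
    using fibre_point[OF True] assms by (metis less_irrefl)
  then obtain i m where im: "H x + real i * \<rho> = of_int m" by blast
  have less: "(f ^^ i) x < (f ^^ i) y" using funpow_strict_on_fibre[OF im] True assms by simp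
  \<comment> \<open>The images of \<open>x\<close> and \<open>y\<close> may be the ends of the flat
    interval; their midpoint is certainly interior.\<close>
  define z where "z = ((f ^^ i) x + (f ^^ i) y) / 2"
  have "H ((f ^^ i) x) = of_int m" "H ((f ^^ i) y) = of_int m" using im True by (simp_all add: H_funpow)
  then have b: "\<alpha> + of_int m \<le> (f ^^ i) x" "(f ^^ i) y \<le> \<beta> + of_int m" using fibre_int_iff by auto
  have "continuous_on {x..y} (f ^^ i)" by (rule continuous_on_subset[OF funpow_cont]) simp
  then have "\<exists>w\<ge>x. w \<le> y \<and> (f ^^ i) w = z"
    using less assms unfolding z_def by (intro IVT') auto
  then obtain w where "x \<le> w" "w \<le> y" "(f ^^ i) w = z" by blast
  then show thesis using meets_flat[of w m i] less b unfolding z_def by auto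
next
  case False
  then have "0 < H y - H x" using monoD[OF H_mono, of x y] assms by simp
  then obtain n m where nm: "0 < n" "0 < real n * \<rho> + of_int m" "real n * \<rho> + of_int m < H y - H x"
    by (rule small_positive_step[OF irr])
  have "H ((f ^^ n) x + of_int m) = H x + (real n * \<rho> + of_int m)"
    by (simp add: HL.shift_int H_funpow)
  then have "x < (f ^^ n) x + of_int m" "(f ^^ n) x + of_int m < y"
    using nm by (rule_tac H_less_imp, simp)+
  then show thesis by (intro returns[OF nm(1), of m]) auto
qed

end

section \<open>Conjugacy of lifts\<close>

locale flat_rotation_pair = F: flat_rotation f \<alpha> \<beta> H \<rho> + G: flat_rotation g \<alpha>' \<beta>' K \<rho>
  for f g :: "real \<Rightarrow> real" and \<alpha> \<beta> \<alpha>' \<beta>' :: real and H K and \<rho>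
begin

definition flat_map :: "real \<Rightarrow> real" where
  "flat_map u = \<alpha>' + (u - \<alpha>) * ((\<beta>' - \<alpha>') / (\<beta> - \<alpha>))"

text \<open>
  The conjugacy maps fibres to fibres; on the fibres that reach the flat interval after \<open>i\<close> steps
  it is pulled back from the affine map between the flat intervals.
\<close>

definition corresponds :: "real \<Rightarrow> real \<Rightarrow> bool" where
  "corresponds x y \<longleftrightarrow> K y = H x \<and>
     (\<forall>(i::nat) (m::int). H x + real i * \<rho> = of_int m \<longrightarrow>
        (g ^^ i) y = flat_map ((f ^^ i) x - of_int m) + of_int m)"

lemma flat_map_less_iff: "flat_map u < flat_map v \<longleftrightarrow> u < v"
proof -
  have "0 < (\<beta>' - \<alpha>') / (\<beta> - \<alpha>)" using F.\<alpha>_less G.\<alpha>_less by simp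
  from mult_less_cancel_right_pos[OF this, of "u - \<alpha>" "v - \<alpha>"]
  show ?thesis unfolding flat_map_def by linarith
qed

lemma flat_map_bounds: "\<alpha>' \<le> flat_map u \<and> flat_map u \<le> \<beta>' \<longleftrightarrow> \<alpha> \<le> u \<and> u \<le> \<beta>"
proof -
  have "flat_map \<alpha> = \<alpha>'" "flat_map \<beta> = \<beta>'"
    unfolding flat_map_def using F.\<alpha>_less by (simp_all add: field_simps)
  then show ?thesis
    using flat_map_less_iff[of u \<alpha>] flat_map_less_iff[of \<beta> u] by (auto simp: not_less[symmetric])
qed

lemma flat_map_surj: "\<exists>u. flat_map u = v"
proof
  show "flat_map (\<alpha> + (v - \<alpha>') * ((\<beta> - \<alpha>) / (\<beta>' - \<alpha>'))) = v"
    unfolding flat_map_def using F.\<alpha>_less G.\<alpha>_less by simp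
qed

text \<open>By this uniqueness the quantified clause of \<open>corresponds\<close> amounts to at
  most one equation, so existence never has to reconcile two constraints.\<close>

lemma orbit_index_unique:
  assumes "t + real i * \<rho> = of_int m" "t + real j * \<rho> = of_int m'"
  shows "i = j \<and> m = m'"
proof -
  have "of_int (int i - int j) * \<rho> = of_int (m - m')" using assms by (simp add: algebra_simps)
  then have "i = j" using irrational_multiple_ne[OF F.irr, of "int i - int j" "m - m'"] by auto
  with assms show ?thesis by simp
qed

lemma corresponds_ex: "\<exists>y. corresponds x y"
proof (cases "\<exists>i m. H x + real i * \<rho> = of_int m")
  case True
  then obtain i m where im: "H x + real i * \<rho> = of_int m" by blast
  define u where "u = flat_map ((f ^^ i) x - of_int m)"
  have "H ((f ^^ i) x) = of_int m" using im F.H_funpow by simp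
  then have "\<alpha> \<le> (f ^^ i) x - of_int m \<and> (f ^^ i) x - of_int m \<le> \<beta>"
    using F.fibre_int_iff[of "(f ^^ i) x" m] by auto
  then have "\<alpha>' \<le> u \<and> u \<le> \<beta>'" unfolding u_def flat_map_bounds .
  then have "K (u + of_int m) = H x + real i * \<rho>"
    unfolding im using G.fibre_int_iff[of "u + of_int m" m] by simp
  then obtain y where "K y = H x" "(g ^^ i) y = u + of_int m" using G.funpow_fibre_surj by blast
  then have "corresponds x y"
    unfolding corresponds_def u_def using orbit_index_unique[OF im] by blast
  then show ?thesis by blast
next
  case False
  then show ?thesis using G.HL_surj[of "H x"] unfolding corresponds_def by blast
qed

lemma corresponds_ex': "\<exists>x. corresponds x y"
proof (cases "\<exists>i m. K y + real i * \<rho> = of_int m")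
  case True
  then obtain i m where im: "K y + real i * \<rho> = of_int m" by blast
  obtain u where u: "flat_map u = (g ^^ i) y - of_int m" using flat_map_surj by blast
  have "K ((g ^^ i) y) = of_int m" using im G.H_funpow by simp
  then have "\<alpha>' \<le> flat_map u \<and> flat_map u \<le> \<beta>'"
    using G.fibre_int_iff[of "(g ^^ i) y" m] u by auto
  then have "H (u + of_int m) = K y + real i * \<rho>"
    unfolding im flat_map_bounds using F.fibre_int_iff[of "u + of_int m" m] by simp
  then obtain x where x: "H x = K y" "(f ^^ i) x = u + of_int m" using F.funpow_fibre_surj by blast
  have "(g ^^ i) y = flat_map ((f ^^ i) x - of_int m) + of_int m" using u x(2) by simp
  then have "corresponds x y"
    unfolding corresponds_def x(1) using orbit_index_unique[OF im] by blast
  then show ?thesis by blast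
next
  case False
  obtain x where "H x = K y" using F.HL_surj by blast
  with False show ?thesis unfolding corresponds_def by metis
qed

text \<open>Different fibres are ordered by \<open>H\<close>. Within one fibre the order is decided
  at the flat interval: \<open>f ^^ i\<close> is strictly increasing on the way there, and
  monotonicity of \<open>g ^^ i\<close> pulls the order back.\<close>

lemma corresponds_mono:
  assumes "corresponds x y" "corresponds x' y'" "x < x'"
  shows "y < y'"
proof (cases "H x = H x'")
  case True
  then obtain i m where im: "H x + real i * \<rho> = of_int m"
    using F.fibre_point[OF True] assms(3) by (metis less_irrefl)
  have "(f ^^ i) x < (f ^^ i) x'" using F.funpow_strict_on_fibre[OF im] True assms(3) by simp
  then have "(g ^^ i) y < (g ^^ i) y'"
    using assms(1,2) im True unfolding corresponds_def by (simp add: flat_map_less_iff)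
  then show ?thesis using monoD[OF G.funpow_mono[of i], of y' y] by force
next
  case False
  then have "H x < H x'" using monoD[OF F.H_mono, of x x'] assms(3) by simp
  then show ?thesis using assms(1,2) G.H_less_imp unfolding corresponds_def by simp
qed

text \<open>The same argument with \<open>f\<close> and \<open>g\<close> exchanged. It is this
  direction that makes the correspondent of a point unique.\<close>

lemma corresponds_mono':
  assumes "corresponds x y" "corresponds x' y'" "y < y'"
  shows "x < x'"
proof (cases "K y = K y'")
  case True
  then obtain i m where im: "K y + real i * \<rho> = of_int m"
    using G.fibre_point[OF True] assms(3) by (metis less_irrefl)
  have "(g ^^ i) y < (g ^^ i) y'" using G.funpow_strict_on_fibre[OF im] True assms(3) by simp
  then have "(f ^^ i) x < (f ^^ i) x'"
    using assms(1,2) im True unfolding corresponds_def by (simp add: flat_map_less_iff)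
  then show ?thesis using monoD[OF F.funpow_mono[of i], of x' x] by force
next
  case False
  then have "K y < K y'" using monoD[OF G.H_mono, of y y'] assms(3) by simp
  then show ?thesis using assms(1,2) F.H_less_imp unfolding corresponds_def by simp
qed

lemma corresponds_unique: "corresponds x y \<Longrightarrow> corresponds x y' \<Longrightarrow> y = y'"
  using corresponds_mono'[of x y x y'] corresponds_mono'[of x y' x y] by fastforce

lemma corresponds_shift:
  assumes "corresponds x y"
  shows "corresponds (x + 1) (y + 1)"
  unfolding corresponds_def
proof (intro conjI allI impI)
  show "K (y + 1) = H (x + 1)" using assms F.H_shift1 G.H_shift1 unfolding corresponds_def by simp
  fix i m assume "H (x + 1) + real i * \<rho> = of_int m"
  then have "H x + real i * \<rho> = of_int (m - 1)" using F.H_shift1[of x] by simp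
  then have "(g ^^ i) y = flat_map ((f ^^ i) x - of_int (m - 1)) + of_int (m - 1)"
    using assms unfolding corresponds_def by blast
  then show "(g ^^ i) (y + 1) = flat_map ((f ^^ i) (x + 1) - of_int m) + of_int m"
    using F.funpow_shift_int[of i x 1] G.funpow_shift_int[of i y 1] by (simp add: algebra_simps)
qed

lemma corresponds_image:
  assumes "corresponds x y"
  shows "corresponds (f x) (g y)"
  unfolding corresponds_def
proof (intro conjI allI impI)
  show "K (g y) = H (f x)" using assms F.H_f G.H_f unfolding corresponds_def by simp
  fix i m assume "H (f x) + real i * \<rho> = of_int m"
  then have "H x + real (Suc i) * \<rho> = of_int m" using F.H_f[of x] by (simp add: algebra_simps)
  then have "(g ^^ Suc i) y = flat_map ((f ^^ Suc i) x - of_int m) + of_int m"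
    using assms unfolding corresponds_def by blast
  then show "(g ^^ i) (g y) = flat_map ((f ^^ i) (f x) - of_int m) + of_int m"
    by (simp add: funpow_swap1)
qed

lemma lifts_conjugate:
  obtains k where "continuous_on UNIV k" "strict_mono k" "surj k"
    "\<And>x. k (x + 1) = k x + 1" "\<And>x. k (f x) = g (k x)"
proof -
  define k where "k x = (SOME y. corresponds x y)" for x
  have k: "corresponds x (k x)" for x unfolding k_def using someI_ex[OF corresponds_ex] .
  have sm: "strict_mono k" by (rule strict_monoI) (rule corresponds_mono[OF k k])
  have "surj k" using corresponds_ex' corresponds_unique[OF k] by (metis surjI surj_def)
  \<comment> \<open>A monotone surjection has no jumps; \<open>corresponds\<close> itself says
    nothing about continuity.\<close>
  moreover have "continuous_on UNIV k"
    using \<open>surj k\<close> strict_mono_mono[OF sm] by (intro continuous_onI_mono) (auto dest: monoD)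
  ultimately show thesis
    using sm corresponds_unique[OF k corresponds_shift[OF k]] corresponds_unique[OF k corresponds_image[OF k]]
    by (intro that[of k]) auto
qed

end

section \<open>Circle maps and their lifts\<close>

lemma cproj_eq_iff: "cproj x = cproj y \<longleftrightarrow> (\<exists>n::int. x = y + of_int n)"
proof -
  have "cproj x = cproj y \<longleftrightarrow> (\<exists>n::int. \<i> * of_real (2 * pi * x) = \<i> * of_real (2 * pi * y) + (of_int (2 * n) * pi) * \<i>)"
    unfolding cproj_def cis_conv_exp exp_eq by simp
  also have "\<dots> \<longleftrightarrow> (\<exists>n::int. x = y + of_int n)"
  proof (intro ex_cong1)
    fix n :: int
    have "\<i> * of_real (2 * pi * x) = \<i> * of_real (2 * pi * y) + (of_int (2 * n) * pi) * \<i>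
      \<longleftrightarrow> 2 * pi * x = 2 * pi * (y + of_int n)"
      by (simp add: complex_eq_iff algebra_simps)
    then show "\<i> * of_real (2 * pi * x) = \<i> * of_real (2 * pi * y) + (of_int (2 * n) * pi) * \<i>
      \<longleftrightarrow> x = y + of_int n" by simp
  qed
  finally show ?thesis .
qed

lemma cproj_shift_int [simp]: "cproj (x + of_int n) = cproj x"
  unfolding cproj_eq_iff by blast

lemma norm_cproj [simp]: "norm (cproj x) = 1"
  unfolding cproj_def by simp

lemma cproj_in_circle [simp]: "cproj x \<in> circle"
  by simp

lemma cproj_derivative: "(cproj has_vector_derivative (2 * pi * \<i> * cproj x)) (at x within S)"
proof -
  have "((\<lambda>z. exp (2 * pi * \<i> * z)) has_field_derivative 2 * pi * \<i> * exp (2 * pi * \<i> * of_real x)) (at (of_real x))"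
    by (auto intro!: derivative_eq_intros)
  then have "((\<lambda>x. exp (2 * pi * \<i> * of_real x)) has_vector_derivative 2 * pi * \<i> * exp (2 * pi * \<i> * of_real x))
      (at x within S)"
    by (rule has_vector_derivative_real_field)
  then show ?thesis unfolding cproj_def cis_conv_exp by (simp add: mult_ac)
qed

lemma continuous_on_cproj: "continuous_on S cproj"
  using cproj_derivative has_vector_derivative_continuous unfolding continuous_on_eq_continuous_within by blast

text \<open>The logarithm of \<open>z / cproj x\<close> measures the angle from the base point,
  which gives an explicit local inverse of the covering. It yields surjectivity and later the
  continuity of the conjugacy on the circle.\<close>

lemma cproj_polar:
  assumes "z \<in> circle"
  shows "cproj (x + Im (Ln (z / cproj x)) / (2 * pi)) = z"
proof -
  define w where "w = z / cproj x"
  have w: "norm w = 1" unfolding w_def using assms by (simp add: norm_divide)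
  then have "w \<noteq> 0" by auto
  have "Re (Ln w) = 0" using w \<open>w \<noteq> 0\<close> by simp
  then have "Ln w = \<i> * of_real (Im (Ln w))" by (simp add: complex_eq_iff)
  then have "exp (\<i> * of_real (Im (Ln w))) = w" using exp_Ln[OF \<open>w \<noteq> 0\<close>] by simp
  then have "cis (Im (Ln w)) = w" unfolding cis_conv_exp by simp
  then have "cis (2 * pi * x) * cis (Im (Ln w)) = z"
    using norm_cproj[of x] unfolding w_def cproj_def by (auto simp: cis_neq_zero)
  then have "cproj (x + Im (Ln w) / (2 * pi)) = z"
    unfolding cproj_def by (simp add: cis_mult algebra_simps)
  then show ?thesis unfolding w_def .
qed

lemma cproj_surj: "z \<in> circle \<Longrightarrow> \<exists>x. cproj x = z"
  using cproj_polar by blast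

text \<open>Distinct values are at least 1 apart. Asking only for integer differences fits a lift
  over the flat arc as well as the difference of two lifts.\<close>

lemma integer_valued_constant:
  fixes g :: "real \<Rightarrow> real"
  assumes "connected S" "continuous_on S g" "\<And>x y. x \<in> S \<Longrightarrow> y \<in> S \<Longrightarrow> g x - g y \<in> \<int>"
  shows "g constant_on S"
proof (rule continuous_discrete_range_constant[OF assms(1,2)])
  fix x assume "x \<in> S"
  have "1 \<le> norm (g y - g x)" if y: "y \<in> S" "g y \<noteq> g x" for y
  proof -
    obtain k where k: "g y - g x = of_int k" using assms(3)[OF y(1) \<open>x \<in> S\<close>] by (auto elim: Ints_cases)
    with y(2) have "k \<noteq> 0" by auto
    then have "1 \<le> \<bar>k\<bar>" by simp
    then show ?thesis unfolding k by simp
  qed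
  then show "\<exists>e>0. \<forall>y. y \<in> S \<and> g y \<noteq> g x \<longrightarrow> e \<le> norm (g y - g x)"
    by (intro exI[of _ 1]) auto
qed

lemma lifts_differ_by_int:
  assumes "is_lift F f" "is_lift F g"
  obtains k :: int where "\<And>x. g x = f x + of_int k"
proof -
  have int: "\<exists>n::int. g x = f x + of_int n" for x
    using assms cproj_eq_iff[of "g x" "f x"] unfolding is_lift_def by auto
  have "(\<lambda>x. g x - f x) constant_on UNIV"
  proof (rule integer_valued_constant)
    show "continuous_on UNIV (\<lambda>x. g x - f x)"
      using assms unfolding is_lift_def by (intro continuous_on_diff) auto
    show "(g x - f x) - (g y - f y) \<in> \<int>" for x y
      using int[of x] int[of y] by auto
  qed auto
  then obtain c where "\<And>x. g x - f x = c" unfolding constant_on_def by auto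
  then have c: "g x = f x + c" for x by (simp add: diff_eq_eq add.commute)
  with int[of 0] obtain k :: int where "c = of_int k" by auto
  with c that show thesis by simp
qed

section \<open>Iterates and rotation numbers of lifts\<close>

lemma lift_funpow:
  assumes "is_lift F f"
  shows "(F ^^ n) (cproj x) = cproj ((f ^^ n) x)"
  using assms unfolding is_lift_def by (induction n) auto

lemma funpow_translate:
  assumes "degree_one_lift f"
  shows "((\<lambda>x. f x + of_int k) ^^ n) x = (f ^^ n) x + of_int (int n * k)"
proof -
  interpret degree_one_lift f by fact
  have "f ((f ^^ n) x + of_int (int n * k)) = f ((f ^^ n) x) + of_int (int n * k)" for n
    by (rule shift_int)
  then show ?thesis by (induction n) (auto simp: algebra_simps)
qed

lemma rotation_number_eq:
  assumes "is_lift F f" "degree_one_lift f" and lim: "\<And>x. (\<lambda>n. (f ^^ n) x / real n) \<longlonglongrightarrow> \<rho>"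
  shows "rotation_number F = frac \<rho>"
  unfolding rotation_number_def
proof (rule the_equality)
  show "\<forall>g x. is_lift F g \<longrightarrow> (\<exists>l. (\<lambda>n. (g ^^ n) x / real n) \<longlonglongrightarrow> l \<and> frac \<rho> = frac l)"
  proof (intro allI impI)
    fix g x assume "is_lift F g"
    then obtain k where k: "\<And>x. g x = f x + of_int k" using lifts_differ_by_int[OF assms(1)] by blast
    then have g: "g = (\<lambda>x. f x + of_int k)" by auto
    have "(\<lambda>n. (f ^^ n) x / real n + of_int k) \<longlonglongrightarrow> \<rho> + of_int k"
      by (intro tendsto_intros lim)
    moreover have "(g ^^ n) x = (f ^^ n) x + of_int (int n * k)" for n
      unfolding g by (rule funpow_translate[OF assms(2)])
    then have "\<forall>\<^sub>F n in sequentially. (f ^^ n) x / real n + of_int k = (g ^^ n) x / real n"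
      by (intro eventually_sequentiallyI[of 1]) (simp add: add_divide_distrib)
    ultimately have "(\<lambda>n. (g ^^ n) x / real n) \<longlonglongrightarrow> \<rho> + of_int k"
      by (rule Lim_transform_eventually)
    then show "\<exists>l. (\<lambda>n. (g ^^ n) x / real n) \<longlonglongrightarrow> l \<and> frac \<rho> = frac l"
      by (intro exI[of _ "\<rho> + of_int k"]) (simp add: frac_def)
  qed
  fix r assume "\<forall>g x. is_lift F g \<longrightarrow> (\<exists>l. (\<lambda>n. (g ^^ n) x / real n) \<longlonglongrightarrow> l \<and> r = frac l)"
  then obtain l where l: "(\<lambda>n. (f ^^ n) 0 / real n) \<longlonglongrightarrow> l" "r = frac l" using assms(1) by blast
  then show "r = frac \<rho>" using LIMSEQ_unique[OF l(1) lim[of 0]] by simp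
qed

lemma obtain_lift:
  assumes "monotone_degree_one F"
  obtains f where "is_lift F f" "degree_one_lift f"
    "\<And>n x. \<bar>(f ^^ n) x - x - real n * rotation_number F\<bar> \<le> 1"
proof -
  obtain g where g: "is_lift F g" "mono g" "\<And>x. g (x + 1) = g x + 1"
    using assms unfolding monotone_degree_one_def by blast
  interpret g: degree_one_lift g
    using g unfolding is_lift_def by unfold_locales auto
  obtain \<rho> where \<rho>: "\<And>x. (\<lambda>n. (g ^^ n) x / real n) \<longlonglongrightarrow> \<rho>"
    "\<And>n x. \<bar>(g ^^ n) x - x - real n * \<rho>\<bar> \<le> 1"
    using g.rotation_limit by blast
  have r: "rotation_number F = frac \<rho>" by (rule rotation_number_eq[OF g(1) g.degree_one_lift_axioms \<rho>(1)])
  \<comment> \<open>Among all lifts this is the one whose translation number equals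
    \<open>rotation_number F\<close> itself, not only modulo 1.\<close>
  define f where "f x = g x + of_int (- \<lfloor>\<rho>\<rfloor>)" for x
  have ff: "f = (\<lambda>x. g x + of_int (- \<lfloor>\<rho>\<rfloor>))" unfolding f_def by auto
  show thesis
  proof (rule that[of f])
    show "is_lift F f"
      using g(1) unfolding is_lift_def ff cproj_shift_int by (auto intro!: continuous_intros)
    show "degree_one_lift f"
      unfolding ff using g.cont g.mono_f g.shift1 by unfold_locales (auto intro!: continuous_intros simp: mono_def)
    show "\<bar>(f ^^ n) x - x - real n * rotation_number F\<bar> \<le> 1" for n x
      using \<rho>(2)[of n x] unfolding ff funpow_translate[OF g.degree_one_lift_axioms] r frac_def
      by (simp add: algebra_simps)
  qed
qed

section \<open>Regularity of the lift\<close>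

lemma continuous_derivative_Lipschitz:
  fixes g :: "real \<Rightarrow> real"
  assumes "\<And>x. x \<in> {a..b} \<Longrightarrow> (g has_vector_derivative g' x) (at x)" "continuous_on {a..b} g'"
  obtains L where "0 \<le> L" "\<And>x y. x \<in> {a..b} \<Longrightarrow> y \<in> {a..b} \<Longrightarrow> \<bar>g x - g y\<bar> \<le> L * \<bar>x - y\<bar>"
proof -
  have "bounded (g' ` {a..b})" using assms(2) compact_continuous_image compact_imp_bounded by blast
  then obtain L where L: "0 < L" "\<And>x. x \<in> {a..b} \<Longrightarrow> norm (g' x) \<le> L"
    unfolding bounded_pos by auto
  have "norm (g x - g y) \<le> L * norm (x - y)" if "x \<in> {a..b}" "y \<in> {a..b}" for x y
    by (rule field_differentiable_bound[OF convex_closed_interval _ L(2) that, where f = g])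
       (use assms(1) in \<open>auto simp: has_real_derivative_iff_has_vector_derivative intro: has_vector_derivative_at_within\<close>)
  then show thesis using that[of L] L by auto
qed

text \<open>Differentiating \<open>E (g y) = c y\<close> exhibits \<open>c'\<close> as
  \<open>D\<close> times a vector. Vector values cover both uses: \<open>c\<close> the identity for
  a real diffeomorphism, and \<open>c = cproj\<close> for a lift.\<close>

lemma inverse_derivative_nonzero:
  fixes g :: "real \<Rightarrow> real" and E c :: "real \<Rightarrow> 'a::real_normed_vector"
  assumes g: "(g has_real_derivative D) (at x)" and E: "(E has_vector_derivative E') (at (g x))"
    and S: "open S" "x \<in> S" "\<And>y. y \<in> S \<Longrightarrow> E (g y) = c y"
    and c: "(c has_vector_derivative c') (at x)" "c' \<noteq> 0"
  shows "D \<noteq> 0"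
proof
  assume "D = 0"
  have "((E \<circ> g) has_vector_derivative D *\<^sub>R E') (at x)"
    using vector_diff_chain_at[of g D x E E'] g E unfolding has_real_derivative_iff_has_vector_derivative by blast
  then have "(c has_vector_derivative D *\<^sub>R E') (at x)"
    by (rule has_vector_derivative_transform_within_open[OF _ S(1,2)]) (simp add: S(3))
  then have "c' = D *\<^sub>R E'" using c(1) vector_derivative_unique_at by blast
  with c(2) \<open>D = 0\<close> show False by simp
qed

text \<open>The smooth inverse keeps the derivative away from 0, so it has constant sign on the
  interval. The sign stays open here; only the monotonicity of \<open>f\<close> decides it.\<close>

lemma diffeo_derivative_bounds:
  assumes h: "C2_diffeo_on h {-\<delta><..<\<delta>}" and r: "0 < r" "r < \<delta>"
  obtains h' m M L where "\<And>z. z \<in> {0..r} \<Longrightarrow> (h has_real_derivative h' z) (at z)"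
    "0 < m" "\<And>z. z \<in> {0..r} \<Longrightarrow> m \<le> \<bar>h' z\<bar> \<and> \<bar>h' z\<bar> \<le> M"
    "0 \<le> L" "\<And>y z. y \<in> {0..r} \<Longrightarrow> z \<in> {0..r} \<Longrightarrow> \<bar>h' y - h' z\<bar> \<le> L * \<bar>y - z\<bar>"
    "(\<forall>z\<in>{0..r}. 0 < h' z) \<or> (\<forall>z\<in>{0..r}. h' z < 0)"
proof -
  define S where "S = {-\<delta><..<\<delta>}"
  have sub: "{0..r} \<subseteq> S" using r unfolding S_def by auto
  obtain h' where h': "\<And>z. z \<in> S \<Longrightarrow> (h has_vector_derivative h' z) (at z)" "h' C1_differentiable_on S"
    using h unfolding C2_diffeo_on_def C2_on_def S_def by blast
  obtain k where k: "\<And>z. z \<in> h ` S \<Longrightarrow> (the_inv_into S h has_vector_derivative k z) (at z)"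
    using h unfolding C2_diffeo_on_def C2_on_def S_def by blast
  have "inj_on h S" using h unfolding C2_diffeo_on_def S_def by blast
  have h'r: "(h has_real_derivative h' z) (at z)" if "z \<in> {0..r}" for z
    using h'(1) sub that unfolding has_real_derivative_iff_has_vector_derivative by blast
  have nz: "h' z \<noteq> 0" if "z \<in> {0..r}" for z
  proof (rule inverse_derivative_nonzero[OF h'r[OF that]])
    show "(the_inv_into S h has_vector_derivative k (h z)) (at (h z))" using k sub that by blast
    show "open S" "z \<in> S" using sub that unfolding S_def by auto
    show "the_inv_into S h (h y) = y" if "y \<in> S" for y using the_inv_into_f_f[OF \<open>inj_on h S\<close> that] .
    show "((\<lambda>y. y) has_vector_derivative 1) (at z)" by (rule has_vector_derivative_id)
  qed simp
  obtain h'' where h'': "\<And>z. z \<in> {0..r} \<Longrightarrow> (h' has_vector_derivative h'' z) (at z)" "continuous_on {0..r} h''"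
    using h'(2) sub continuous_on_subset unfolding C1_differentiable_on_def by (metis subsetD)
  obtain L where L: "0 \<le> L" "\<And>x y. x \<in> {0..r} \<Longrightarrow> y \<in> {0..r} \<Longrightarrow> \<bar>h' x - h' y\<bar> \<le> L * \<bar>x - y\<bar>"
    using continuous_derivative_Lipschitz[OF h''] by blast
  have cont: "continuous_on {0..r} h'"
    using h''(1) has_vector_derivative_continuous continuous_at_imp_continuous_on by blast
  then have cabs: "continuous_on {0..r} (\<lambda>z. \<bar>h' z\<bar>)" by (intro continuous_intros)
  obtain z1 where z1: "z1 \<in> {0..r}" "\<forall>z\<in>{0..r}. \<bar>h' z1\<bar> \<le> \<bar>h' z\<bar>"
    using continuous_attains_inf[OF _ _ cabs] r by auto
  obtain z2 where z2: "z2 \<in> {0..r}" "\<forall>z\<in>{0..r}. \<bar>h' z\<bar> \<le> \<bar>h' z2\<bar>"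
    using continuous_attains_sup[OF _ _ cabs] r by auto
  have sign: "(\<forall>z\<in>{0..r}. 0 < h' z) \<or> (\<forall>z\<in>{0..r}. h' z < 0)"
  proof (rule ccontr)
    assume "\<not> ?thesis"
    then obtain x y where xy: "x \<in> {0..r}" "y \<in> {0..r}" "h' x < 0" "0 < h' y"
      using nz by (metis not_less_iff_gr_or_eq)
    have "connected (h' ` {0..r})" using connected_continuous_image[OF cont] by simp
    then have "0 \<in> h' ` {0..r}"
      using xy connectedD_interval[of "h' ` {0..r}" "h' x" "h' y" 0] by auto
    with nz show False by auto
  qed
  show thesis
    using that[of h' "\<bar>h' z1\<bar>" "\<bar>h' z2\<bar>" L] h'r nz[OF z1(1)] z1(2) z2(2) L sign by auto
qed

lemma closure_arc: "closure (cproj ` {a<..<b}) \<subseteq> cproj ` {a..b}"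
proof (rule closure_minimal)
  show "closed (cproj ` {a..b})"
    using compact_continuous_image[OF continuous_on_cproj compact_Icc] compact_imp_closed by blast
qed auto

lemma circle_diffeo_lift_derivative:
  assumes F: "is_lift F f" and diffeo: "circle_C2_diffeo_on F V" and f: "mono f"
    and S: "open S" "S \<subseteq> cproj -` V"
  obtains f' f'' where "\<And>x. x \<in> S \<Longrightarrow> (f has_real_derivative f' x) (at x)" "\<And>x. x \<in> S \<Longrightarrow> 0 < f' x"
    "\<And>x. x \<in> S \<Longrightarrow> (f' has_vector_derivative f'' x) (at x)" "continuous_on S f''"
proof -
  have fc: "continuous_on UNIV f" and Ff: "\<And>x. F (cproj x) = cproj (f x)"
    using F unfolding is_lift_def by auto
  define G where "G x = cproj (f x)" for x
  have G: "F \<circ> cproj = G" unfolding G_def using Ff by auto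
  obtain G' where "\<And>x. x \<in> cproj -` V \<Longrightarrow> (G has_vector_derivative G' x) (at x)"
    "G' C1_differentiable_on cproj -` V"
    using diffeo unfolding circle_C2_diffeo_on_def circle_C2_on_def C2_on_def G by blast
  then have G': "\<And>x. x \<in> S \<Longrightarrow> (G has_vector_derivative G' x) (at x)" "G' C1_differentiable_on S"
    using S(2) C1_differentiable_on_subset by blast+
  obtain G'' where G'': "\<And>x. x \<in> S \<Longrightarrow> (G' has_vector_derivative G'' x) (at x)" "continuous_on S G''"
    using G'(2) unfolding C1_differentiable_on_def by blast
  \<comment> \<open>From \<open>G = cproj \<circ> f\<close> one expects \<open>G'\<close> to be
    \<open>2 * pi * \<i> * f' * G\<close>; as \<open>G\<close> has norm 1, multiplying by its
    conjugate isolates \<open>f'\<close>.\<close>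
  define f' where "f' x = Im (G' x * cnj (G x)) / (2 * pi)" for x
  define f'' where "f'' x = Im (G'' x * cnj (G x) + G' x * cnj (G' x)) / (2 * pi)" for x
  have Gn: "norm (G x) = 1" for x unfolding G_def by simp
  have inv: "G' x / G x = G' x * cnj (G x)" for x
    using complex_div_cnj[of "G' x" "G x"] Gn[of x] by simp
  have f_der: "(f has_real_derivative f' x) (at x)" if x: "x \<in> S" for x
  proof -
    \<comment> \<open>The bound 1/2 keeps the angle between \<open>G x\<close> and
      \<open>G y\<close> below pi, so the principal logarithm recovers \<open>f y - f x\<close>
      exactly.\<close>
    obtain d where d: "0 < d" "\<And>y. dist y x < d \<Longrightarrow> dist (f y) (f x) < 1 / 2"
      using fc[unfolded continuous_on_iff, rule_format, of x "1 / 2"] by auto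
    have Gx: "G x \<noteq> 0" using Gn[of x] by auto
    have "((\<lambda>y. G y / G x) has_vector_derivative G' x / G x) (at x)"
      by (rule has_vector_derivative_divide[OF G'(1)[OF x]])
    moreover have "(Ln has_field_derivative inverse (G x / G x)) (at (G x / G x))"
      using Gx by (intro has_field_derivative_Ln) auto
    ultimately have "(Ln \<circ> (\<lambda>y. G y / G x) has_vector_derivative G' x / G x * inverse (G x / G x)) (at x)"
      by (rule field_vector_diff_chain_at)
    then have "((\<lambda>y. Ln (G y / G x)) has_vector_derivative G' x * cnj (G x)) (at x)"
      using Gx by (simp add: o_def inv)
    then have "((\<lambda>y. Im (Ln (G y / G x))) has_vector_derivative Im (G' x * cnj (G x))) (at x)"
      by (rule bounded_linear.has_vector_derivative[OF bounded_linear_Im])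
    then have "((\<lambda>y. Im (Ln (G y / G x))) has_real_derivative Im (G' x * cnj (G x))) (at x)"
      by (simp only: has_real_derivative_iff_has_vector_derivative)
    from DERIV_add[OF DERIV_const[of "f x"] DERIV_cdivide[OF this, of "2 * pi"]]
    have "((\<lambda>y. f x + Im (Ln (G y / G x)) / (2 * pi)) has_real_derivative f' x) (at x)"
      unfolding f'_def by simp
    then show ?thesis
    proof (rule has_field_derivative_transform_within_open)
      show "open (ball x d)" "x \<in> ball x d" using d by auto
      fix y assume "y \<in> ball x d"
      then have y: "\<bar>f y - f x\<bar> < 1 / 2" using d(2)[of y] by (simp add: dist_real_def abs_minus_commute)
      have "G y / G x = cis (2 * pi * (f y - f x))"
        unfolding G_def cproj_def by (simp add: cis_divide algebra_simps)
      also have "\<dots> = exp (\<i> * of_real (2 * pi * (f y - f x)))" by (simp add: cis_conv_exp)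
      also have "Ln \<dots> = \<i> * of_real (2 * pi * (f y - f x))"
      proof (rule Ln_exp)
        have "2 * pi * \<bar>f y - f x\<bar> < 2 * pi * (1 / 2)" using y by (intro mult_strict_left_mono) auto
        then have "\<bar>2 * pi * (f y - f x)\<bar> < pi" by (simp add: abs_mult)
        then show "- pi < Im (\<i> * of_real (2 * pi * (f y - f x)))"
          "Im (\<i> * of_real (2 * pi * (f y - f x))) \<le> pi"
          unfolding Im_i_times Re_complex_of_real by (simp_all only: abs_less_iff) linarith+
      qed
      finally have "Im (Ln (G y / G x)) = 2 * pi * (f y - f x)" by simp
      then show "f x + Im (Ln (G y / G x)) / (2 * pi) = f y" by simp
    qed
  qed
  \<comment> \<open>Along \<open>f\<close> this inverse of \<open>F\<close> on the covering becomes
    \<open>cproj\<close> itself, whose derivative never vanishes.\<close>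
  define E where "E = the_inv_into V F \<circ> cproj"
  obtain E' where E': "\<And>z. z \<in> cproj -` (F ` V) \<Longrightarrow> (E has_vector_derivative E' z) (at z)"
    using diffeo unfolding circle_C2_diffeo_on_def circle_C2_on_def C2_on_def E_def by blast
  have "inj_on F V" using diffeo unfolding circle_C2_diffeo_on_def by blast
  have f'_pos: "0 < f' x" if x: "x \<in> S" for x
  proof -
    have "cproj x \<in> V" using x S by auto
    have "f' x \<noteq> 0"
    proof (rule inverse_derivative_nonzero[OF f_der[OF x]])
      have "cproj (f x) = F (cproj x)" using Ff by simp
      then show "(E has_vector_derivative E' (f x)) (at (f x))" using \<open>cproj x \<in> V\<close> by (intro E') auto
      show "open S" "x \<in> S" by fact+
      show "E (f y) = cproj y" if "y \<in> S" for y
        using the_inv_into_f_f[OF \<open>inj_on F V\<close>, of "cproj y"] that S(2) Ff[of y] unfolding E_def by auto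
      show "(cproj has_vector_derivative 2 * pi * \<i> * cproj x) (at x)" by (rule cproj_derivative)
      show "2 * pi * \<i> * cproj x \<noteq> 0" using cis_neq_zero unfolding cproj_def by simp
    qed
    moreover have "0 \<le> f' x"
      using mono_on_imp_deriv_nonneg[of UNIV f "f' x" x] f f_der[OF x] by simp
    ultimately show ?thesis by simp
  qed
  have f'_der: "(f' has_vector_derivative f'' x) (at x)" if x: "x \<in> S" for x
  proof -
    have "((\<lambda>x. G' x * cnj (G x)) has_vector_derivative G' x * cnj (G' x) + G'' x * cnj (G x)) (at x)"
      by (intro has_vector_derivative_mult G'' x bounded_linear.has_vector_derivative[OF bounded_linear_cnj] G')
    then have "((\<lambda>x. Im (G' x * cnj (G x))) has_vector_derivative Im (G' x * cnj (G' x) + G'' x * cnj (G x))) (at x)"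
      by (rule bounded_linear.has_vector_derivative[OF bounded_linear_Im])
    from has_vector_derivative_divide[OF this, of "2 * pi"]
    show ?thesis unfolding f'_def f''_def by (simp add: add.commute)
  qed
  have "continuous_on S G"
    using has_vector_derivative_continuous[OF G'(1)] by (simp add: continuous_at_imp_continuous_on)
  moreover have "continuous_on S G'"
    using has_vector_derivative_continuous[OF G''(1)] by (simp add: continuous_at_imp_continuous_on)
  ultimately have "continuous_on S f''"
    using G''(2) unfolding f''_def by (intro continuous_intros) auto
  then show thesis by (intro that[of f' f''] f_der f'_pos f'_der)
qed

section \<open>Pieces next to the flat interval\<close>

lemma tame_right:
  assumes law: "right_power_law f \<beta> p" and p: "1 \<le> p" and f: "\<And>x. \<beta> < x \<Longrightarrow> x \<le> t \<Longrightarrow> f \<beta> < f x" and "\<beta> < t"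
  obtains e0 where "0 < e0" "\<And>e. 0 < e \<Longrightarrow> e \<le> e0 \<Longrightarrow> \<exists>C\<ge>0. tame f \<beta> (\<beta> + 2 * e) C"
proof -
  obtain h \<delta> \<epsilon> where h: "0 < \<delta>" "0 < \<epsilon>" "C2_diffeo_on h {-\<delta><..<\<delta>}"
    "\<And>x. x \<in> {\<beta>..<\<beta> + \<epsilon>} \<Longrightarrow> f x = h ((x - \<beta>) powr p)"
    using law unfolding right_power_law_def by blast
  \<comment> \<open>The fractions make room for a piece of length \<open>2 * e\<close>: it stays
    within the range of the law and the domain of \<open>h\<close>, has length at most 1 and ends no
    later than \<open>t\<close>.\<close>
  define e0 where "e0 = min (min (\<delta> / 4) (\<epsilon> / 4)) (min (1 / 2) ((t - \<beta>) / 2))"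
  have "0 < e0" using h(1,2) \<open>\<beta> < t\<close> unfolding e0_def by simp
  moreover have "e0 \<le> min (\<delta> / 4) (\<epsilon> / 4)" "e0 \<le> min (1 / 2) ((t - \<beta>) / 2)"
    unfolding e0_def by (rule min.cobounded1 min.cobounded2)+
  ultimately have e0: "0 < e0" "e0 \<le> \<delta> / 4" "e0 \<le> \<epsilon> / 4" "e0 \<le> 1 / 2" "e0 \<le> (t - \<beta>) / 2"
    by linarith+
  show thesis
  proof (rule that[OF e0(1)])
    fix e assume e: "0 < e" "e \<le> e0"
    define r where "r = 2 * e"
    have r: "0 < r" "r \<le> 1" "r < \<delta>" "r < \<epsilon>" "r \<le> t - \<beta>" using e e0 h unfolding r_def by auto
    have rp: "0 < r powr p" "r powr p < \<delta>"
      using r p powr_mono'[of 1 p r] by auto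
    obtain h' m M L where h': "\<And>z. z \<in> {0..r powr p} \<Longrightarrow> (h has_real_derivative h' z) (at z)"
      "0 < m" "\<And>z. z \<in> {0..r powr p} \<Longrightarrow> m \<le> \<bar>h' z\<bar> \<and> \<bar>h' z\<bar> \<le> M"
      "0 \<le> L" "\<And>y z. y \<in> {0..r powr p} \<Longrightarrow> z \<in> {0..r powr p} \<Longrightarrow> \<bar>h' y - h' z\<bar> \<le> L * \<bar>y - z\<bar>"
      "(\<forall>z\<in>{0..r powr p}. 0 < h' z) \<or> (\<forall>z\<in>{0..r powr p}. h' z < 0)"
      by (rule diffeo_derivative_bounds[OF h(3) rp]) (rule that)
    \<comment> \<open>One mean value decides the sign of \<open>h'\<close>: \<open>h\<close> is
      larger at \<open>r powr p\<close> than at 0, because \<open>f\<close> is larger at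
      \<open>\<beta> + r\<close> than at \<beta>.\<close>
    have "\<exists>\<xi>>0. \<xi> < r powr p \<and> h (r powr p) - h 0 = (r powr p - 0) * h' \<xi>"
      using rp by (intro MVT2 h') auto
    then obtain \<xi> where "0 < \<xi>" "\<xi> < r powr p" "h (r powr p) - h 0 = (r powr p - 0) * h' \<xi>" by blast
    then have \<xi>: "\<xi> \<in> {0..r powr p}" "h (r powr p) - h 0 = r powr p * h' \<xi>" by simp_all
    have "h 0 < h (r powr p)" using f[of "\<beta> + r"] h(4)[of \<beta>] h(4)[of "\<beta> + r"] r h p by simp
    then have "0 < h' \<xi>" using \<xi>(2) rp by (metis diff_gt_0_iff_gt zero_less_mult_pos)
    then have "\<not> (\<forall>z\<in>{0..r powr p}. h' z < 0)" using \<xi>(1) by (meson less_asym)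
    then have pos: "\<And>z. z \<in> {0..r powr p} \<Longrightarrow> 0 < h' z" using h'(6) by blast
    obtain C where "0 \<le> C" "tame f (\<beta> + 0) (\<beta> + r) C"
    proof (rule tame_power_piece[of p 0 r h h' m M L \<beta> f])
      fix z assume "0 powr p \<le> z" "z \<le> r powr p"
      then have z: "z \<in> {0..r powr p}" by simp
      show "(h has_real_derivative h' z) (at z)" by (rule h'(1)[OF z])
      show "m \<le> h' z \<and> h' z \<le> M" using h'(3)[OF z] pos[OF z] by simp
    next
      fix y z assume "0 powr p \<le> y" "y \<le> r powr p" "0 powr p \<le> z" "z \<le> r powr p"
      then show "\<bar>h' y - h' z\<bar> \<le> L * \<bar>y - z\<bar>" by (intro h'(5)) auto
    next
      fix x assume "\<beta> + 0 \<le> x" "x \<le> \<beta> + r"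
      then show "f x = h ((x - \<beta>) powr p)" using h(4)[of x] r by simp
    qed (use p r h'(2,4) in auto)
    then show "\<exists>C\<ge>0. tame f \<beta> (\<beta> + 2 * e) C" unfolding r_def by auto
  qed
qed

lemma right_power_law_mirror:
  assumes "left_power_law f a p"
  shows "right_power_law (\<lambda>x. - f (- x)) (- a) p"
proof -
  obtain h \<delta> \<epsilon> where h: "0 < \<delta>" "0 < \<epsilon>" "C2_diffeo_on h {-\<delta><..<\<delta>}"
    "\<And>x. x \<in> {a - \<epsilon><..a} \<Longrightarrow> f x = h ((a - x) powr p)"
    using assms unfolding left_power_law_def by blast
  define S where "S = {-\<delta><..<\<delta>}"
  define g where "g = (\<lambda>z. - h z)"
  have C2: "C2_on (\<lambda>z. - k z) T" if k: "C2_on k T" for k :: "real \<Rightarrow> real" and T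
  proof -
    obtain k' where "\<forall>t\<in>T. (k has_vector_derivative k' t) (at t)" and k': "k' C1_differentiable_on T"
      using k unfolding C2_on_def by blast
    then have "\<forall>t\<in>T. ((\<lambda>z. - k z) has_vector_derivative - k' t) (at t)"
      using has_vector_derivative_minus by blast
    with C1_differentiable_on_minus[OF k'] show ?thesis
      unfolding C2_on_def by (intro exI[of _ "\<lambda>t. - k' t"]) simp
  qed
  have C2': "C2_on (\<lambda>z. k (- z)) (uminus ` T)" if k: "C2_on k T" for k :: "real \<Rightarrow> real" and T
  proof -
    obtain k' where k': "\<And>t. t \<in> T \<Longrightarrow> (k has_vector_derivative k' t) (at t)" "k' C1_differentiable_on T"
      using k unfolding C2_on_def by blast
    obtain k'' where k'': "\<And>t. t \<in> T \<Longrightarrow> (k' has_vector_derivative k'' t) (at t)" "continuous_on T k''"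
      using k'(2) unfolding C1_differentiable_on_def by blast
    have chain: "((\<lambda>z. q (- z)) has_vector_derivative - q' (- t)) (at t)"
      if q: "\<And>t. t \<in> T \<Longrightarrow> (q has_vector_derivative q' t) (at t)" and t: "t \<in> uminus ` T"
      for q q' :: "real \<Rightarrow> real" and t
    proof -
      have "- t \<in> T" using t by auto
      have "((\<lambda>z. - z) has_vector_derivative - 1) (at t)"
        using has_vector_derivative_minus[OF has_vector_derivative_id[of "at t"]] by simp
      from vector_diff_chain_at[OF this q[OF \<open>- t \<in> T\<close>]] show ?thesis by (simp add: o_def)
    qed
    have d1: "((\<lambda>z. k (- z)) has_vector_derivative - k' (- t)) (at t)" if "t \<in> uminus ` T" for t
      by (rule chain[OF k'(1) that])
    have "((\<lambda>z. - k' (- z)) has_vector_derivative k'' (- t)) (at t)" if "t \<in> uminus ` T" for t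
      using has_vector_derivative_minus[OF chain[OF k''(1) that]] by simp
    moreover have "continuous_on (uminus ` T) (\<lambda>t. k'' (- t))"
      by (rule continuous_on_compose2[OF k''(2)]) (auto intro: continuous_on_minus continuous_on_id)
    ultimately have "(\<lambda>t. - k' (- t)) C1_differentiable_on uminus ` T"
      unfolding C1_differentiable_on_def by (intro exI[of _ "\<lambda>t. k'' (- t)"]) simp
    with d1 show ?thesis unfolding C2_on_def by (intro exI[of _ "\<lambda>t. - k' (- t)"]) simp
  qed
  have hS: "open (h ` S)" "inj_on h S" "C2_on h S" "C2_on (the_inv_into S h) (h ` S)"
    using h(3) unfolding C2_diffeo_on_def S_def by simp_all
  have gS: "g ` S = uminus ` h ` S" unfolding g_def by (simp add: image_image)
  have "C2_diffeo_on g S"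
    unfolding C2_diffeo_on_def
  proof (intro conjI)
    show "open S" unfolding S_def by simp
    show "inj_on g S" using hS(2) unfolding g_def inj_on_def by simp
    show "open (g ` S)" using open_negations[OF hS(1)] unfolding gS .
    show "C2_on g S" using C2[OF hS(3)] unfolding g_def .
    have "C2_on (\<lambda>z. the_inv_into S h (- z)) (g ` S)" using C2'[OF hS(4)] unfolding gS .
    moreover have "the_inv_into S g = (\<lambda>z. the_inv_into S h (- z))"
    proof
      fix z
      have "(- h x = z) = (h x = - z)" for x by auto
      then show "the_inv_into S g z = the_inv_into S h (- z)" unfolding the_inv_into_def g_def by (simp only:)
    qed
    ultimately show "C2_on (the_inv_into S g) (g ` S)" by simp
  qed
  moreover have "\<forall>x\<in>{- a..<- a + \<epsilon>}. - f (- x) = g ((x - (- a)) powr p)"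
  proof
    fix x assume "x \<in> {- a..<- a + \<epsilon>}"
    then have "f (- x) = h ((a - (- x)) powr p)" by (intro h(4)) auto
    then show "- f (- x) = g ((x - (- a)) powr p)" unfolding g_def by (simp add: add.commute)
  qed
  ultimately show ?thesis
    unfolding right_power_law_def S_def
    by (intro exI[of _ g] exI[of _ \<delta>] exI[of _ \<epsilon>] conjI h(1,2))
qed

lemma tame_left:
  assumes law: "left_power_law f a p" and p: "1 \<le> p" and f: "\<And>x. t \<le> x \<Longrightarrow> x < a \<Longrightarrow> f x < f a" and "t < a"
  obtains e0 where "0 < e0" "\<And>e. 0 < e \<Longrightarrow> e \<le> e0 \<Longrightarrow> \<exists>C\<ge>0. tame f (a - 2 * e) a C"
proof -
  have "- f (- (- a)) < - f (- x)" if "- a < x" "x \<le> - t" for x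
    using f[of "- x"] that by simp
  then obtain e0 where e0: "0 < e0"
    "\<And>e. 0 < e \<Longrightarrow> e \<le> e0 \<Longrightarrow> \<exists>C\<ge>0. tame (\<lambda>x. - f (- x)) (- a) (- a + 2 * e) C"
    using tame_right[OF right_power_law_mirror[OF law] p, of "- t"] \<open>t < a\<close> by (metis neg_less_iff_less)
  show thesis
  proof (rule that[OF e0(1)])
    fix e assume "0 < e" "e \<le> e0"
    then obtain C where C: "0 \<le> C" "tame (\<lambda>x. - f (- x)) (- a) (- a + 2 * e) C" using e0(2) by blast
    from tame_mirror[OF C(2)] have "tame f (a - 2 * e) a C" by simp
    with C(1) show "\<exists>C\<ge>0. tame f (a - 2 * e) a C" by blast
  qed
qed

lemma obtain_flat_rotation:
  assumes F: "almost_smooth_flat F U pl pr" and irr: "rotation_number F \<notin> \<rat>"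
  obtains f \<alpha> \<beta> H where "is_lift F f" "U = cproj ` {\<alpha><..<\<beta>}"
    "flat_rotation f \<alpha> \<beta> H (rotation_number F)"
proof -
  obtain \<alpha> \<beta> where arc: "is_arc_lift U \<alpha> \<beta>"
    using F unfolding almost_smooth_flat_def open_arc_def by blast
  then have \<alpha>\<beta>: "\<alpha> < \<beta>" "\<beta> \<le> \<alpha> + 1" and U: "U = cproj ` {\<alpha><..<\<beta>}"
    unfolding is_arc_lift_def by auto
  have mdo: "monotone_degree_one F" and p: "1 \<le> pl" "1 \<le> pr"
    and diffeo: "circle_C2_diffeo_on F (circle - closure U)"
    using F unfolding almost_smooth_flat_def by auto
  obtain c where c: "F ` U = {c}" using F unfolding almost_smooth_flat_def by blast
  obtain f where f: "is_lift F f" "degree_one_lift f"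
    and bd: "\<And>n x. \<bar>(f ^^ n) x - x - real n * rotation_number F\<bar> \<le> 1"
    using obtain_lift[OF mdo] by blast
  interpret degree_one_lift f by fact
  have law: "right_power_law f \<beta> pr" using F f(1) arc unfolding almost_smooth_flat_def by blast
  \<comment> \<open>The strictly increasing arc runs from \<beta> to \<alpha> + 1, so the left law
    is taken at the next lift of \<open>U\<close>.\<close>
  have "is_arc_lift U (\<alpha> + 1) (\<beta> + 1)"
  proof -
    have "cproj x \<in> cproj ` {\<alpha> + 1<..<\<beta> + 1}" if "x \<in> {\<alpha><..<\<beta>}" for x
      using that cproj_shift_int[of x 1] by (intro image_eqI[of _ _ "x + 1"]) auto
    moreover have "cproj x \<in> cproj ` {\<alpha><..<\<beta>}" if "x \<in> {\<alpha> + 1<..<\<beta> + 1}" for x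
      using that cproj_shift_int[of x "-1"] by (intro image_eqI[of _ _ "x - 1"]) auto
    ultimately show ?thesis using \<alpha>\<beta> unfolding is_arc_lift_def U by auto
  qed
  then have law': "left_power_law f (\<alpha> + 1) pl" using F f(1) unfolding almost_smooth_flat_def by blast
  have flat: "f x = f \<alpha>" if "\<alpha> \<le> x" "x \<le> \<beta>" for x
  proof -
    have "f constant_on {\<alpha><..<\<beta>}"
    proof (rule integer_valued_constant)
      show "continuous_on {\<alpha><..<\<beta>} f" using cont by (rule continuous_on_subset) simp
      fix x y assume "x \<in> {\<alpha><..<\<beta>}" "y \<in> {\<alpha><..<\<beta>}"
      then have "F (cproj x) = F (cproj y)" using c unfolding U by (metis image_eqI singletonD)
      then have "cproj (f x) = cproj (f y)" using f(1) unfolding is_lift_def by simp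
      then obtain n :: int where "f x = f y + of_int n" unfolding cproj_eq_iff by blast
      then show "f x - f y \<in> \<int>" by simp
    qed simp
    then obtain v where v: "\<And>x. x \<in> {\<alpha><..<\<beta>} \<Longrightarrow> f x = v" unfolding constant_on_def by blast
    have cl: "closure {\<alpha><..<\<beta>} = {\<alpha>..\<beta>}" using \<alpha>\<beta> by (intro closure_greaterThanLessThan)
    have "f x = v" if "x \<in> {\<alpha>..\<beta>}" for x
    proof (rule continuous_constant_on_closure[of "{\<alpha><..<\<beta>}" f v x])
      show "continuous_on (closure {\<alpha><..<\<beta>}) f" using cont by (rule continuous_on_subset) simp
    qed (use v that cl in auto)
    then show ?thesis using that \<alpha>\<beta> by simp
  qed
  \<comment> \<open>A flat arc of full length would make \<open>f\<close> constant over a period,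
    against degree one.\<close>
  have "\<beta> \<noteq> \<alpha> + 1" using flat[of \<beta>] shift1[of \<alpha>] \<alpha>\<beta> by auto
  with \<alpha>\<beta> have \<beta>: "\<beta> < \<alpha> + 1" by simp
  define S where "S = {\<beta><..<\<alpha> + 1}"
  have S: "open S" "S \<subseteq> cproj -` (circle - closure U)"
  proof -
    have "cproj x \<notin> cproj ` {\<alpha>..\<beta>}" if "x \<in> S" for x
    proof
      assume "cproj x \<in> cproj ` {\<alpha>..\<beta>}"
      then obtain y and n :: int where y: "\<alpha> \<le> y" "y \<le> \<beta>" "x = y + of_int n"
        unfolding image_iff cproj_eq_iff by auto
      then have "0 < real_of_int n" "real_of_int n < 1" using that unfolding S_def by auto
      then show False by auto
    qed
    then have "cproj x \<in> circle - closure U" if "x \<in> S" for x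
      using closure_arc[of \<alpha> \<beta>] cproj_in_circle[of x] that unfolding U by blast
    then show "S \<subseteq> cproj -` (circle - closure U)" by blast
  qed (simp add: S_def)
  obtain f' f'' where f': "\<And>x. x \<in> S \<Longrightarrow> (f has_real_derivative f' x) (at x)" "\<And>x. x \<in> S \<Longrightarrow> 0 < f' x"
    and f'': "\<And>x. x \<in> S \<Longrightarrow> (f' has_vector_derivative f'' x) (at x)" "continuous_on S f''"
    using circle_diffeo_lift_derivative[OF f(1) diffeo mono_f S] by blast
  have strict: "f x < f y" if xy: "\<beta> \<le> x" "x < y" "y \<le> \<alpha> + 1" for x y
  proof (rule DERIV_pos_imp_increasing_open[OF xy(2)])
    show "\<exists>d. (f has_real_derivative d) (at z) \<and> 0 < d" if "x < z" "z < y" for z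
      using f'[of z] that xy unfolding S_def by auto
    show "continuous_on {x..y} f" using cont by (rule continuous_on_subset) simp
  qed
  interpret flat_interval_lift f \<alpha> \<beta>
    by unfold_locales (use \<alpha>\<beta> \<beta> flat strict in blast)+
  obtain e1 where e1: "0 < e1" "\<And>e. 0 < e \<Longrightarrow> e \<le> e1 \<Longrightarrow> \<exists>C\<ge>0. tame f \<beta> (\<beta> + 2 * e) C"
    using tame_right[OF law p(2), of "\<alpha> + 1"] strict \<beta> by blast
  obtain e2 where e2: "0 < e2" "\<And>e. 0 < e \<Longrightarrow> e \<le> e2 \<Longrightarrow> \<exists>C\<ge>0. tame f (\<alpha> + 1 - 2 * e) (\<alpha> + 1) C"
    using tame_left[OF law' p(1), of \<beta>] strict \<beta> by blast
  define e where "e = min (min e1 e2) ((\<alpha> + 1 - \<beta>) / 4)"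
  have e: "0 < e" using e1(1) e2(1) \<beta> unfolding e_def by simp
  have "e \<le> min e1 e2" "e \<le> (\<alpha> + 1 - \<beta>) / 4" unfolding e_def by (rule min.cobounded1 min.cobounded2)+
  then have e': "e \<le> e1" "e \<le> e2" "4 * e \<le> \<alpha> + 1 - \<beta>" by simp_all
  obtain C1 where C1: "0 \<le> C1" "tame f \<beta> (\<beta> + 2 * e) C1" using e1(2) e e' by blast
  obtain C2 where C2: "0 \<le> C2" "tame f (\<alpha> + 1 - 2 * e) (\<alpha> + 1) C2" using e2(2) e e' by blast
  obtain C3 where C3: "0 \<le> C3" "tame f (\<beta> + e) (\<alpha> + 1 - e) C3"
  proof -
    define I where "I = {\<beta> + e..\<alpha> + 1 - e}"
    have IS: "I \<subseteq> S" using e unfolding I_def S_def by auto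
    obtain L where L: "0 \<le> L" "\<And>x y. x \<in> I \<Longrightarrow> y \<in> I \<Longrightarrow> \<bar>f' x - f' y\<bar> \<le> L * \<bar>x - y\<bar>"
      using continuous_derivative_Lipschitz[of "\<beta> + e" "\<alpha> + 1 - e" f' f''] f'' IS continuous_on_subset
      unfolding I_def by (metis subsetD)
    have "continuous_on I f'"
      using has_vector_derivative_continuous[OF f''(1)] IS
      by (intro continuous_at_imp_continuous_on) auto
    moreover have "compact I" "I \<noteq> {}" using e e' unfolding I_def by auto
    ultimately obtain z1 z2 where z: "z1 \<in> I" "\<forall>x\<in>I. f' z1 \<le> f' x" "z2 \<in> I" "\<forall>x\<in>I. f' x \<le> f' z2"
      using continuous_attains_inf[of I f'] continuous_attains_sup[of I f'] by blast
    have one: "z powr 1 = z" if "e \<le> z" for z using that e by simp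
    have in_I: "z + \<beta> \<in> I" if "e powr 1 \<le> z" "z \<le> (\<alpha> + 1 - e - \<beta>) powr 1" for z
      using that e e' unfolding I_def by (simp add: one)
    \<comment> \<open>The interior is a power piece of exponent 1, based at \<beta> and starting at
      distance \<open>e\<close> from it.\<close>
    obtain C where C: "0 \<le> C" "tame f (\<beta> + e) (\<beta> + (\<alpha> + 1 - e - \<beta>)) C"
    proof (rule tame_power_piece[of 1 e "\<alpha> + 1 - e - \<beta>" "\<lambda>z. f (z + \<beta>)" "\<lambda>z. f' (z + \<beta>)" "f' z1" "f' z2" L \<beta> f])
      fix z assume "e powr 1 \<le> z" "z \<le> (\<alpha> + 1 - e - \<beta>) powr 1"
      then have zI: "z + \<beta> \<in> I" by (rule in_I)
      then show "((\<lambda>z. f (z + \<beta>)) has_real_derivative f' (z + \<beta>)) (at z)"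
        using f'(1)[of "z + \<beta>"] IS by (auto simp: DERIV_shift)
      show "f' z1 \<le> f' (z + \<beta>) \<and> f' (z + \<beta>) \<le> f' z2" using z zI by blast
    next
      fix y z assume "e powr 1 \<le> y" "y \<le> (\<alpha> + 1 - e - \<beta>) powr 1" "e powr 1 \<le> z" "z \<le> (\<alpha> + 1 - e - \<beta>) powr 1"
      then show "\<bar>f' (y + \<beta>) - f' (z + \<beta>)\<bar> \<le> L * \<bar>y - z\<bar>"
        using L(2)[OF in_I in_I, of y z] by simp
    next
      fix x assume "\<beta> + e \<le> x"
      then show "f x = f ((x - \<beta>) powr 1 + \<beta>)" using e by simp
    next
      show "0 < f' z1" using f'(2) z(1) IS by blast
      show "e < \<alpha> + 1 - e - \<beta>" "\<alpha> + 1 - e - \<beta> \<le> 1" using e e' \<alpha>\<beta> by linarith+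
    qed (use e L(1) in auto)
    have "\<beta> + (\<alpha> + 1 - e - \<beta>) = \<alpha> + 1 - e" by simp
    with C show thesis using that[of C] by metis
  qed
  define C where "C = C1 + C2 + C3"
  obtain C' where C': "0 \<le> C'" "bounded_distortion f \<alpha> \<beta> C'"
  proof (rule bounded_distortionI[OF e e'(3), of C])
    show "tame f \<beta> (\<beta> + 2 * e) C"
      by (rule tame_constant_mono[OF C1(2) _ mono_f]) (use C2 C3 in \<open>simp add: C_def\<close>)
    show "tame f (\<alpha> + 1 - 2 * e) (\<alpha> + 1) C"
      by (rule tame_constant_mono[OF C2(2) _ mono_f]) (use C1 C3 in \<open>simp add: C_def\<close>)
    show "tame f (\<beta> + e) (\<alpha> + 1 - e) C"
      by (rule tame_constant_mono[OF C3(2) _ mono_f]) (use C1 C2 in \<open>simp add: C_def\<close>)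
    show "0 \<le> C" using C1(1) C2(1) C3(1) unfolding C_def by simp
  qed
  obtain H where H: "rotation_semiconjugacy f H (rotation_number F)"
    using obtain_semiconjugacy[OF irr bd] by blast
  interpret H: rotation_semiconjugacy f H "rotation_number F" by fact
  have "flat_rotation f \<alpha> \<beta> (\<lambda>x. H x - H \<alpha>) (rotation_number F)"
  proof unfold_locales
    show "continuous_on UNIV (\<lambda>x. H x - H \<alpha>)" using H.H_cont by (intro continuous_intros)
    show "mono (\<lambda>x. H x - H \<alpha>)" using H.H_mono by (simp add: mono_def)
    show "\<exists>C\<ge>0. bounded_distortion f \<alpha> \<beta> C" using C' by blast
  qed (simp_all add: irr H.H_shift1 H.H_f)
  then show thesis using that f(1) U by blast
qed

section \<open>Wandering intervals and conjugacy\<close>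

lemma no_wandering_interval_of_flat_map:
  assumes F: "almost_smooth_flat F U pl pr" and irr: "rotation_number F \<notin> \<rat>"
  shows "\<not> wandering_interval F U J"
proof
  assume J: "wandering_interval F U J"
  obtain f \<alpha> \<beta> H where f: "is_lift F f" and U: "U = cproj ` {\<alpha><..<\<beta>}"
    and "flat_rotation f \<alpha> \<beta> H (rotation_number F)"
    using obtain_flat_rotation[OF assms] by blast
  interpret flat_rotation f \<alpha> \<beta> H "rotation_number F" by fact
  \<comment> \<open>\<open>J\<close> avoids \<open>U\<close>, so it lies in the image of this arc.
    The arc is compact and shorter than 1, hence the covering has a continuous inverse there and
    \<open>J\<close> lifts to the line. Both ends belong to \<open>I\<close>, as \<open>J\<close>
    may contain boundary points of \<open>U\<close>.\<close>
  define I where "I = {\<beta>..\<alpha> + 1}"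
  have inj: "x = y" if "cproj x = cproj y" "x \<in> I" "y \<in> I" for x y
  proof -
    obtain n :: int where n: "x = y + of_int n" using \<open>cproj x = cproj y\<close> cproj_eq_iff by blast
    have "\<bar>x - y\<bar> < 1" using that(2,3) \<alpha>_less unfolding I_def by auto
    then have "\<bar>real_of_int n\<bar> < 1" using n by simp
    then have "n = 0" by linarith
    then show ?thesis using n by simp
  qed
  have cover: "\<exists>x\<in>I. cproj x = z" if z: "z \<in> circle" "z \<notin> U" for z
  proof -
    obtain x0 where x0: "cproj x0 = z" using cproj_surj[OF z(1)] by blast
    define x where "x = x0 - of_int \<lfloor>x0 - \<alpha>\<rfloor>"
    have x: "cproj x = z" unfolding x_def using cproj_shift_int[of x0 "- \<lfloor>x0 - \<alpha>\<rfloor>"] x0 by simp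
    have x1: "\<alpha> \<le> x" "x < \<alpha> + 1" unfolding x_def by linarith+
    have "x \<notin> {\<alpha><..<\<beta>}" using z(2) x unfolding U by blast
    then consider "x = \<alpha>" | "x \<in> I" using x1 unfolding I_def by fastforce
    then show ?thesis
    proof cases
      case 1
      then have "cproj (\<alpha> + 1) = z" using cproj_shift_int[of \<alpha> 1] x by simp
      moreover have "\<alpha> + 1 \<in> I" using \<alpha>_less unfolding I_def by simp
      ultimately show ?thesis by blast
    qed (use x in blast)
  qed
  define q where "q = the_inv_into I cproj"
  have inj_on: "inj_on cproj I" using inj by (auto intro: inj_onI)
  have q: "q (cproj x) = x" if "x \<in> I" for x unfolding q_def using the_inv_into_f_f[OF inj_on that] .
  have "continuous_on (cproj ` I) q"
    by (rule continuous_on_inv[OF continuous_on_cproj]) (use q in \<open>auto simp: I_def\<close>)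
  have Jc: "J \<subseteq> circle" "connected J" and avoid: "\<And>n. J \<inter> (F ^^ n) -` U = {}"
    and disj: "disjoint_family (\<lambda>i. (F ^^ i) ` J)"
    using J unfolding wandering_interval_def by auto
  have JI: "\<exists>x\<in>I. cproj x = z" if "z \<in> J" for z
  proof (rule cover)
    show "z \<in> circle" using Jc(1) that by blast
    show "z \<notin> U" using avoid[of 0] that by auto
  qed
  then have "J \<subseteq> cproj ` I" by blast
  then have "connected (q ` J)"
    using connected_continuous_image[OF continuous_on_subset[OF \<open>continuous_on (cproj ` I) q\<close>] Jc(2)] by blast
  have cproj_q: "cproj (q z) = z" if "z \<in> J" for z using JI[OF that] q by auto
  obtain z1 z2 where "z1 \<in> J" "z2 \<in> J" "z1 \<noteq> z2" using J unfolding wandering_interval_def by blast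
  then have "q z1 \<noteq> q z2" using cproj_q by metis
  then obtain x y where xy: "x \<in> q ` J" "y \<in> q ` J" "x < y"
    using \<open>z1 \<in> J\<close> \<open>z2 \<in> J\<close> by (metis imageI linorder_neqE_linordered_idom)
  have in_J: "cproj w \<in> J" if "x \<le> w" "w \<le> y" for w
  proof -
    have "w \<in> q ` J" using connectedD_interval[OF \<open>connected (q ` J)\<close> xy(1,2) that] .
    then show ?thesis using cproj_q by auto
  qed
  show False
  proof (rule no_wandering_interval[OF xy(3)])
    fix n :: nat and m :: int and w
    assume meets_flat: "x \<le> w" "w \<le> y" "\<alpha> + of_int m < (f ^^ n) w" "(f ^^ n) w < \<beta> + of_int m"
    have "cproj ((f ^^ n) w) = cproj ((f ^^ n) w + of_int (- m))" by (rule cproj_shift_int[symmetric])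
    also have "\<dots> \<in> U" unfolding U using meets_flat by (intro imageI) auto
    finally have "cproj w \<in> (F ^^ n) -` U" using lift_funpow[OF f, of n w] by simp
    then show False using avoid[of n] in_J[of w] meets_flat by blast
  next
    fix n :: nat and m :: int
    assume returns: "0 < n" "x \<le> (f ^^ n) x + of_int m" "(f ^^ n) x + of_int m \<le> y"
    have "cproj ((f ^^ n) x + of_int m) \<in> J" using returns by (intro in_J) auto
    then have "(F ^^ n) (cproj x) \<in> (F ^^ 0) ` J" using lift_funpow[OF f, of n x] by simp
    moreover have "(F ^^ n) (cproj x) \<in> (F ^^ n) ` J" using in_J[of x] xy(3) by simp
    ultimately show False using disj returns(1) unfolding disjoint_family_on_def by blast
  qed
qed

lemma conjugate_lifts_imp_topologically_conjugate:
  assumes f: "is_lift F f" and g: "is_lift G g"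
    and k: "continuous_on UNIV k" "strict_mono k" "surj k" "\<And>x. k (x + 1) = k x + 1"
    and kf: "\<And>x. k (f x) = g (k x)"
  shows "topologically_conjugate F G"
proof -
  interpret k: degree_one_lift k
    by unfold_locales (rule k(1) strict_mono_mono[OF k(2)] k(4))+
  \<comment> \<open>The choice of preimage does not matter: preimages differ by integers, and
    \<open>k\<close> commutes with integer translations.\<close>
  define s where "s z = (SOME x. cproj x = z)" for z
  define h where "h z = cproj (k (s z))" for z
  have h: "h (cproj x) = cproj (k x)" for x
  proof -
    have "cproj (s (cproj x)) = cproj x" unfolding s_def by (rule someI) (rule refl)
    then obtain n :: int where n: "s (cproj x) = x + of_int n" unfolding cproj_eq_iff by blast
    show ?thesis unfolding h_def n k.shift_int by (rule cproj_shift_int)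
  qed
  have "continuous_on circle h"
    unfolding continuous_on_eq_continuous_within
  proof
    fix z assume "z \<in> circle"
    then obtain x where x: "cproj x = z" using cproj_surj by blast
    then have "z \<noteq> 0" using norm_cproj[of x] by auto
    \<comment> \<open>Near \<open>z\<close> the arbitrary choice of preimage is replaced by the
      branch of the angle based at \<open>x\<close>, which is continuous at \<open>z\<close>; on the
      circle the resulting map is the same.\<close>
    define p where "p w = cproj (k (x + Im (Ln (w / z)) / (2 * pi)))" for w
    have arg: "isCont (\<lambda>w. x + Im (Ln (w / z)) / (2 * pi)) z"
    proof -
      have "z / z \<notin> \<real>\<^sub>\<le>\<^sub>0" using \<open>z \<noteq> 0\<close> by simp
      then have "isCont (\<lambda>w. Ln (w / z)) z" using \<open>z \<noteq> 0\<close> by (intro isCont_Ln' isCont_divide) auto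
      then show ?thesis
        unfolding isCont_def by (intro tendsto_add tendsto_divide tendsto_Im tendsto_const) simp_all
    qed
    have k_cont: "isCont k y" for y
      using k(1) unfolding continuous_on_eq_continuous_at[OF open_UNIV] by blast
    have cproj_cont: "isCont cproj y" for y
      by (rule has_vector_derivative_continuous[OF cproj_derivative])
    have "isCont p z" unfolding p_def by (rule isCont_o2[OF isCont_o2[OF arg k_cont] cproj_cont])
    then have "continuous (at z within circle) p" by (rule continuous_at_imp_continuous_at_within)
    then show "continuous (at z within circle) h"
    proof (rule continuous_transform_within[OF _ zero_less_one \<open>z \<in> circle\<close>])
      fix w assume "w \<in> circle"
      then have w: "cproj (x + Im (Ln (w / z)) / (2 * pi)) = w" using cproj_polar[of w x] unfolding x by blast
      show "p w = h w" using h[of "x + Im (Ln (w / z)) / (2 * pi)"] unfolding w p_def by (rule sym)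
    qed
  qed
  moreover have "h ` circle = circle"
  proof
    show "h ` circle \<subseteq> circle" unfolding h_def by auto
    show "circle \<subseteq> h ` circle"
    proof
      fix z assume "z \<in> circle"
      then obtain y where "cproj y = z" using cproj_surj by blast
      moreover obtain x where "k x = y" using k(3) by (metis surjD)
      ultimately have "z = h (cproj x)" by (simp add: h)
      then show "z \<in> h ` circle" using cproj_in_circle by blast
    qed
  qed
  moreover have "inj_on h circle"
  proof (rule inj_onI)
    fix z w assume "z \<in> circle" "w \<in> circle" and eq: "h z = h w"
    then obtain x y where xy: "cproj x = z" "cproj y = w" using cproj_surj by metis
    then obtain n :: int where "k x = k y + of_int n" using eq h cproj_eq_iff by metis
    then have "k x = k (y + of_int n)" by (simp add: k.shift_int)
    then have "x = y + of_int n" using strict_mono_eq[OF k(2)] by blast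
    then show "z = w" using xy by auto
  qed
  ultimately obtain h' where "homeomorphism circle circle h h'"
    using homeomorphism_compact[of circle h circle] by auto
  moreover have "h (F z) = G (h z)" if "z \<in> circle" for z
  proof -
    from that obtain x where x: "cproj x = z" using cproj_surj by blast
    have "F (cproj x) = cproj (f x)" "G (cproj (k x)) = cproj (g (k x))"
      using f g unfolding is_lift_def by blast+
    then have "h (F (cproj x)) = G (h (cproj x))" by (simp only: h kf)
    then show ?thesis unfolding x .
  qed
  ultimately show ?thesis
    unfolding topologically_conjugate_def by (intro exI[of _ h] exI[of _ h'] conjI ballI)
qed

lemma flat_classE:
  assumes "F \<in> flat_class"
  obtains U \<nu> where "almost_smooth_flat F U \<nu> \<nu>" "rotation_number F \<notin> \<rat>"
  using assms unfolding flat_class_def mem_Collect_eq by (elim exE conjE) (rule that)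

theorem mainTheorem2:
  shows "(\<forall>F\<in>flat_class. \<not> has_wandering_interval F) \<and>
         (\<forall>F\<in>flat_class. \<forall>G\<in>flat_class.
            rotation_number F = rotation_number G \<longrightarrow> topologically_conjugate F G)"
proof (intro conjI ballI impI)
  fix F assume "F \<in> flat_class"
  then have irr: "rotation_number F \<notin> \<rat>" by (rule flat_classE)
  show "\<not> has_wandering_interval F"
    unfolding has_wandering_interval_def
    by (intro notI, elim exE conjE) (rule notE[OF no_wandering_interval_of_flat_map[OF _ irr]])
next
  fix F G assume F: "F \<in> flat_class" and G: "G \<in> flat_class" and eq: "rotation_number F = rotation_number G"
  obtain U \<nu> where FU: "almost_smooth_flat F U \<nu> \<nu>" and irr: "rotation_number F \<notin> \<rat>"
    by (rule flat_classE[OF F]) (rule that)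
  obtain V \<mu> where GV: "almost_smooth_flat G V \<mu> \<mu>" and irr': "rotation_number G \<notin> \<rat>"
    by (rule flat_classE[OF G]) (rule that)
  obtain f \<alpha> \<beta> H where f: "is_lift F f" and fr: "flat_rotation f \<alpha> \<beta> H (rotation_number F)"
    by (rule obtain_flat_rotation[OF FU irr]) (rule that)
  obtain g \<alpha>' \<beta>' K where g: "is_lift G g" and "flat_rotation g \<alpha>' \<beta>' K (rotation_number G)"
    by (rule obtain_flat_rotation[OF GV irr']) (rule that)
  then have gr: "flat_rotation g \<alpha>' \<beta>' K (rotation_number F)" unfolding eq by simp
  interpret flat_rotation_pair f g \<alpha> \<beta> \<alpha>' \<beta>' H K "rotation_number F"
    by (rule flat_rotation_pair.intro[OF fr gr])
  obtain k where "continuous_on UNIV k" "strict_mono k" "surj k"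
    "\<And>x. k (x + 1) = k x + 1" "\<And>x. k (f x) = g (k x)"
    by (rule lifts_conjugate) (rule that)
  then show "topologically_conjugate F G"
    by (rule conjugate_lifts_imp_topologically_conjugate[OF f g])
qed

end
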